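(* (Super Peter-Weyl theorem for $S^{1|1}$.) The complex linear span of the matrix coefficients of the representations $\{(\pi_m,\rho^{\pi_m})\}_{m\in\mathbb{Z}}$ and $(\pi_-,\rho^{\pi_-})$ of $S^{1|1}$ is dense in $\mathcal{O}(S^{1|1})\otimes\mathbb{C}$.
   Context: $S^{1|1}$ is the real Lie supergroup given by the super Harish-Chandra pair $(S^1,\mathfrak{g}^{1|1}_{\mathbb{R}})$, where $\mathfrak{g}^{1|1}_{\mathbb{R}}$ is the real form with even part $\mathbb{R}\,iC$ of the complex Lie superalgebra $\mathfrak{g}$ with even basis element $C$, odd basis element $Z$ and $[C,C]=[C,Z]=0$, $[Z,Z]=-2C$; explicitly $\mathfrak{g}^{1|1}_{\mathbb{R}}=\mathrm{span}_{\mathbb{R}}\{iC,bZ\}$ with $b\neq 0$, $b/\overline{b}=i$. $S^1$ acts trivially on it, and $iC$ corresponds to the standard generator of $\mathrm{Lie}(S^1)$. Its complexified algebra of global sections is $\mathcal{O}(S^{1|1})\otimes\mathbb{C}=\mathrm{Hom}_{\mathcal{U}(\mathfrak{g}_0)}(\mathcal{U}(\mathfrak{g}),C^\infty(S^1,\mathbb{C}))$, where $\mathfrak{g}_0=\mathbb{C}\,C$ acts on $C^\infty(S^1,\mathbb{C})$ by (complexified) invariant vector fields. It is identified with $C^\infty(S^1,\mathbb{C})\oplus C^\infty(S^1,\mathbb{C})Z^*$ through $\phi\mapsto\phi(1)+\phi(Z)Z^*$. Its topology is that given by the seminorms $\phi\mapsto\sup_{z\in S^1}|\phi(X)(z)|$,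 $X\in\mathcal{U}(\mathfrak{g})$ (i.e. uniform convergence of the reductions of all invariant derivatives). A complex representation of $S^{1|1}$ on a finite-dimensional complex super vector space $V$ is a pair $(\pi,\rho^\pi)$: a parity-preserving representation $\pi$ of $S^1$ on $V$ and a compatible representation $\rho^\pi$ of $\mathfrak{g}$ on $V$ ($\rho^\pi|_{\mathfrak{g}_0}$ is the complexified differential of $\pi$, and $\rho^\pi$ commutes with $\pi$). For $\omega\in V^*$ and $v\in V$, the matrix coefficient $c_{\omega,v}\in\mathcal{O}(S^{1|1})\otimes\mathbb{C}$ is $c_{\omega,v}(X)(g)=\langle\omega,\pi(g)\rho^\pi(X)v\rangle$ for $X\in\mathcal{U}(\mathfrak{g})$, $g\in S^1$. The representations are: - $(\pi_0,\rho^{\pi_0})$: the trivial representation on $\mathbb{C}$ ($\pi_0(t)=1$, $\rho^{\pi_0}=0$). - For $m\in\mathbb{Z}\setminus\{0\}$, $(\pi_m,\rho^{\pi_m})$: on $\mathbb{C}^{1|1}$, $t\in S^1$ acts as $t^m$, $C$ acts as $m$, and in a homogeneous basis $v_0,v_1$ (one even, one odd) $Z$ acts by $\begin{pmatrix}0&\sqrt{-m}\\ \sqrt{-m}&0\end{pmatrix}$ for a fixed choice of $\sqrt{-m}$. - $(\pi_-,\rho^{\pi_-})$: on $\mathbb{C}^{1|1}$ with homogeneous basis $u,w$ (one even, one odd), $S^1$ acts trivially, $C$ acts by $0$, and $Z\cdot u=w$, $Z\cdot w=0$. *)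

theory Defs
  imports
    "HOL-Analysis.Analysis"
    "HOL-Computational_Algebra.Polynomial"
    "HOL-Library.Poly_Mapping"
    "HOL-Library.Function_Algebras"
begin

section \<open>The circle group\<close>

typedef circle = "{z :: complex. cmod z = 1}"
  morphisms of_circle Circle
  by (rule exI[of _ 1]) simp

setup_lifting type_definition_circle

instantiation circle :: comm_monoid_mult
begin

lift_definition one_circle :: circle is 1 by simp
lift_definition times_circle :: "circle \<Rightarrow> circle \<Rightarrow> circle" is "(*)"
  by (simp add: norm_mult)

instance by standard (transfer, simp add: mult.assoc mult.commute)+

end

lift_definition circle_exp :: "real \<Rightarrow> circle" is cis by simp

text \<open>Smoothness on the circle is smoothness of the pullback along the covering
  \<open>\<theta> \<mapsto> exp (i \<theta>)\<close>, which is a local diffeomorphism.\<close>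

definition smooth_real :: "(real \<Rightarrow> 'a :: real_normed_vector) \<Rightarrow> bool" where
  "smooth_real h \<longleftrightarrow>
     (\<forall>k t. (((\<lambda>u s. vector_derivative u (at s)) ^^ k) h) differentiable (at t))"

definition smooth_circle :: "(circle \<Rightarrow> 'a :: real_normed_vector) \<Rightarrow> bool" where
  "smooth_circle f \<longleftrightarrow> smooth_real (\<lambda>t. f (circle_exp t))"

text \<open>The invariant vector field of the standard generator of the Lie algebra of the circle.\<close>

definition circle_field :: "(circle \<Rightarrow> complex) \<Rightarrow> circle \<Rightarrow> complex" where
  "circle_field f z = vector_derivative (\<lambda>s. f (z * circle_exp s)) (at 0)"

section \<open>The Lie superalgebra and its universal enveloping algebra\<close>

text \<open>The complex Lie superalgebra has the homogeneous basis \<open>GC\<close> (even), \<open>GZ\<close> (odd), and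
  \<open>[Z, Z] = -2 C\<close> is its only nonzero bracket. The real form \<open>span {i C, b Z}\<close> enters the
  complexified sections and the complex representations only through the fact that \<open>i C\<close> is
  the standard generator of the Lie algebra of the circle.\<close>

datatype gen = GC | GZ

fun gen_odd :: "gen \<Rightarrow> bool" where
  "gen_odd GC = False"
| "gen_odd GZ = True"

text \<open>\<open>sbracket x y k\<close> is the coefficient of the basis element \<open>k\<close> in \<open>[x, y]\<close>.\<close>

definition sbracket :: "gen \<Rightarrow> gen \<Rightarrow> gen \<Rightarrow> complex" where
  "sbracket x y k = (if x = GZ \<and> y = GZ \<and> k = GC then -2 else 0)"

definition koszul :: "gen \<Rightarrow> gen \<Rightarrow> complex" where
  "koszul x y = (if gen_odd x \<and> gen_odd y then -1 else 1)"

text \<open>The tensor algebra of the Lie superalgebra is the free algebra on its basis, i.e. the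
  monoid algebra (convolution product of \<^typ>\<open>'a \<Rightarrow>\<^sub>0 'b\<close>) of the monoid of words.\<close>

datatype word = Word (letters: "gen list")

instantiation word :: monoid_add
begin

definition zero_word :: word where "0 = Word []"
definition plus_word :: "word \<Rightarrow> word \<Rightarrow> word" where "v + w = Word (letters v @ letters w)"

instance by standard (simp_all add: zero_word_def plus_word_def)

end

type_synonym tensor_alg = "word \<Rightarrow>\<^sub>0 complex"

definition tconst :: "complex \<Rightarrow> tensor_alg" where
  "tconst c = Poly_Mapping.single 0 c"

definition tgen :: "gen \<Rightarrow> tensor_alg" where
  "tgen x = Poly_Mapping.single (Word [x]) 1"

definition ug_relator :: "gen \<Rightarrow> gen \<Rightarrow> tensor_alg" where
  "ug_relator x y = tgen x * tgen y - tconst (koszul x y) * tgen y * tgen x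
     - (\<Sum>k\<in>{GC, GZ}. tconst (sbracket x y k) * tgen k)"

inductive_set ug_ideal :: "tensor_alg set" where
  zero: "0 \<in> ug_ideal"
| relator: "a * ug_relator x y * b \<in> ug_ideal"
| add: "p \<in> ug_ideal \<Longrightarrow> q \<in> ug_ideal \<Longrightarrow> p + q \<in> ug_ideal"

lemma ug_ideal_mult_left: "p \<in> ug_ideal \<Longrightarrow> a * p \<in> ug_ideal"
proof (induction rule: ug_ideal.induct)
  case (relator b x y c)
  show ?case using ug_ideal.relator[of "a * b" x y c] by (simp add: mult.assoc)
qed (auto simp: distrib_left intro: ug_ideal.zero ug_ideal.add)

lemma ug_ideal_mult_right: "p \<in> ug_ideal \<Longrightarrow> p * a \<in> ug_ideal"
proof (induction rule: ug_ideal.induct)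
  case (relator b x y c)
  show ?case using ug_ideal.relator[of b x y "c * a"] by (simp add: mult.assoc)
qed (auto simp: distrib_right intro: ug_ideal.zero ug_ideal.add)

lemma ug_ideal_uminus: "p \<in> ug_ideal \<Longrightarrow> - p \<in> ug_ideal"
  using ug_ideal_mult_left[of p "-1"] by simp

lemma ug_ideal_diff: "p \<in> ug_ideal \<Longrightarrow> q \<in> ug_ideal \<Longrightarrow> p - q \<in> ug_ideal"
  using ug_ideal.add[of p "- q"] ug_ideal_uminus[of q] by simp

text \<open>Extension of an assignment of matrices to the basis elements to the tensor algebra.
  (The product \<open>**\<close> is the matrix product; \<open>mat c\<close> is a scalar matrix.)\<close>

primrec list_mat :: "(gen \<Rightarrow> complex^'n^'n) \<Rightarrow> gen list \<Rightarrow> complex^'n^'n" where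
  "list_mat \<rho> [] = mat 1"
| "list_mat \<rho> (x # xs) = \<rho> x ** list_mat \<rho> xs"

definition tensor_eval :: "(gen \<Rightarrow> complex^'n^'n) \<Rightarrow> tensor_alg \<Rightarrow> complex^'n^'n" where
  "tensor_eval \<rho> p =
     (\<Sum>w\<in>Poly_Mapping.keys p. mat (Poly_Mapping.lookup p w) ** list_mat \<rho> (letters w))"

definition preserves_bracket :: "(gen \<Rightarrow> complex^'n^'n) \<Rightarrow> bool" where
  "preserves_bracket \<rho> \<longleftrightarrow> (\<forall>x y. \<rho> x ** \<rho> y - mat (koszul x y) ** \<rho> y ** \<rho> x
     = (\<Sum>k\<in>{GC, GZ}. mat (sbracket x y k) ** \<rho> k))"

lemma list_mat_append: "list_mat \<rho> (xs @ ys) = list_mat \<rho> xs ** list_mat \<rho> ys"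
  by (induction xs) (simp_all add: matrix_mul_assoc)

lemma mat_mult_nth: "(mat c ** A) $ i $ j = c * (A :: complex^'n^'n) $ i $ j"
  by (simp add: matrix_matrix_mult_def mat_def if_distrib if_distribR cong: if_cong)

lemma mat_mult_nth': "((A :: complex^'n^'n) ** mat c) $ i $ j = c * A $ i $ j"
  by (simp add: matrix_matrix_mult_def mat_def if_distrib if_distribR mult.commute cong: if_cong)

lemma mat_commute: "mat c ** (A :: complex^'n^'n) = A ** mat c"
  by (simp add: vec_eq_iff mat_mult_nth mat_mult_nth')

lemma mat_mult_mat: "mat c ** mat d = (mat (c * d) :: complex^'n^'n)"
  by (simp add: vec_eq_iff mat_mult_nth) (simp add: mat_def)

lemma matrix_add_rdistrib:
  "((A :: complex^'n^'n) + B) ** C = A ** C + B ** C"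
  by (simp add: vec_eq_iff matrix_matrix_mult_def distrib_right sum.distrib)

lemma tensor_eval_superset:
  assumes "finite S" "Poly_Mapping.keys p \<subseteq> S"
  shows "tensor_eval \<rho> p = (\<Sum>w\<in>S. mat (Poly_Mapping.lookup p w) ** list_mat \<rho> (letters w))"
  unfolding tensor_eval_def
  by (rule sum.mono_neutral_left) (use assms in \<open>auto simp: in_keys_iff vec_eq_iff mat_mult_nth\<close>)

lemma tensor_eval_zero [simp]: "tensor_eval \<rho> 0 = 0"
  by (simp add: tensor_eval_def)

lemma tensor_eval_add: "tensor_eval \<rho> (p + q) = tensor_eval \<rho> p + tensor_eval \<rho> q"
proof -
  let ?S = "Poly_Mapping.keys p \<union> Poly_Mapping.keys q"
  show ?thesis
    using tensor_eval_superset[of ?S "p + q" \<rho>] tensor_eval_superset[of ?S p \<rho>]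
      tensor_eval_superset[of ?S q \<rho>] Poly_Mapping.keys_add[of p q]
    by (simp add: lookup_add sum.distrib[symmetric])
       (rule sum.cong, simp_all add: vec_eq_iff mat_mult_nth distrib_right)
qed

lemma tensor_eval_single:
  "tensor_eval \<rho> (Poly_Mapping.single w c) = mat c ** list_mat \<rho> (letters w)"
  using tensor_eval_superset[of "{w}" "Poly_Mapping.single w c" \<rho>] by simp

lemma tensor_induct [case_names single add]:
  fixes p :: tensor_alg
  assumes "\<And>w c. P (Poly_Mapping.single w c)" "\<And>p q. P p \<Longrightarrow> P q \<Longrightarrow> P (p + q)"
  shows "P p"
proof (induction p rule: update_induct)
  case const
  show ?case using assms(1)[of 0 0] by simp
next
  case (update p w c)
  have "Poly_Mapping.update w c p = p + Poly_Mapping.single w c"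
    using update(1) by (intro poly_mapping_eqI)
      (auto simp: lookup_update lookup_add lookup_single when_def in_keys_iff)
  then show ?case using assms update by auto
qed

lemma tensor_eval_mult: "tensor_eval \<rho> (p * q) = tensor_eval \<rho> p ** tensor_eval \<rho> q"
proof (induction p rule: tensor_induct)
  case (single v c)
  show ?case
  proof (induction q rule: tensor_induct)
    case (single w d)
    have "mat (c * d) ** (list_mat \<rho> (letters v) ** list_mat \<rho> (letters w))
      = mat c ** (mat d ** list_mat \<rho> (letters v)) ** list_mat \<rho> (letters w)"
      by (simp add: mat_mult_mat[symmetric] matrix_mul_assoc)
    also have "\<dots> = mat c ** list_mat \<rho> (letters v) ** (mat d ** list_mat \<rho> (letters w))"
      by (simp add: mat_commute[of d "list_mat \<rho> (letters v)"] matrix_mul_assoc)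
    finally show ?case
      by (simp add: mult_single tensor_eval_single plus_word_def list_mat_append)
  qed (simp add: distrib_left tensor_eval_add matrix_add_ldistrib)
next
  case (add p p')
  then show ?case by (simp add: distrib_right tensor_eval_add matrix_add_rdistrib)
qed

lemma tensor_eval_uminus: "tensor_eval \<rho> (- p) = - tensor_eval \<rho> p"
  using tensor_eval_add[of \<rho> p "- p"] by (simp add: eq_neg_iff_add_eq_0 add.commute)

lemma tensor_eval_diff: "tensor_eval \<rho> (p - q) = tensor_eval \<rho> p - tensor_eval \<rho> q"
  using tensor_eval_add[of \<rho> p "- q"] by (simp add: tensor_eval_uminus)

lemma tensor_eval_tgen [simp]: "tensor_eval \<rho> (tgen x) = \<rho> x"
  by (simp add: tgen_def tensor_eval_single)

lemma tensor_eval_tconst [simp]: "tensor_eval \<rho> (tconst c) = mat c"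
  by (simp add: tconst_def tensor_eval_single zero_word_def)

lemma tensor_eval_ideal:
  assumes "preserves_bracket \<rho>" "p \<in> ug_ideal"
  shows "tensor_eval \<rho> p = 0"
  using assms(2)
proof (induction rule: ug_ideal.induct)
  case (relator a x y b)
  have "tensor_eval \<rho> (ug_relator x y) = 0"
    using assms(1)
    by (simp add: ug_relator_def tensor_eval_diff tensor_eval_mult tensor_eval_add
        preserves_bracket_def)
  then show ?case by (simp add: tensor_eval_mult)
qed (simp_all add: tensor_eval_add)

definition ug_eq :: "tensor_alg \<Rightarrow> tensor_alg \<Rightarrow> bool" where
  "ug_eq p q \<longleftrightarrow> p - q \<in> ug_ideal"

lemma equivp_ug_eq: "equivp ug_eq"
proof (rule equivpI)
  show "reflp ug_eq" by (simp add: reflp_def ug_eq_def ug_ideal.zero)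
  show "symp ug_eq"
    unfolding symp_def ug_eq_def using ug_ideal_uminus by fastforce
  show "transp ug_eq"
    unfolding transp_def ug_eq_def
  proof (intro allI impI)
    fix x y z assume "x - y \<in> ug_ideal" "y - z \<in> ug_ideal"
    from ug_ideal.add[OF this] show "x - z \<in> ug_ideal" by simp
  qed
qed

lemma one_notin_ug_ideal: "1 \<notin> ug_ideal"
proof
  assume "1 \<in> ug_ideal"
  moreover have "preserves_bracket (\<lambda>_. 0 :: complex^1^1)"
    by (simp add: preserves_bracket_def)
  ultimately have "tensor_eval (\<lambda>_. 0 :: complex^1^1) (tconst 1) = 0"
    by (intro tensor_eval_ideal) (simp_all add: tconst_def single_one)
  then show False by (simp add: mat_def vec_eq_iff)
qed

quotient_type ug = tensor_alg / ug_eq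
  by (rule equivp_ug_eq)

instantiation ug :: ring_1
begin

lift_definition zero_ug :: ug is 0 .
lift_definition one_ug :: ug is 1 .
lift_definition plus_ug :: "ug \<Rightarrow> ug \<Rightarrow> ug" is "(+)"
  unfolding ug_eq_def using ug_ideal.add by (fastforce simp: add_diff_add)
lift_definition uminus_ug :: "ug \<Rightarrow> ug" is uminus
  unfolding ug_eq_def using ug_ideal_uminus by fastforce
lift_definition minus_ug :: "ug \<Rightarrow> ug \<Rightarrow> ug" is "(-)"
  unfolding ug_eq_def
proof -
  fix a b c d :: tensor_alg
  assume "a - b \<in> ug_ideal" "c - d \<in> ug_ideal"
  from ug_ideal_diff[OF this] show "a - c - (b - d) \<in> ug_ideal"
    by (simp add: algebra_simps)
qed
lift_definition times_ug :: "ug \<Rightarrow> ug \<Rightarrow> ug" is "(*)"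
  unfolding ug_eq_def
proof -
  fix a b c d :: tensor_alg
  assume 1: "a - b \<in> ug_ideal" and 2: "c - d \<in> ug_ideal"
  have "a * c - b * d = (a - b) * c + b * (c - d)" by (simp add: algebra_simps)
  then show "a * c - b * d \<in> ug_ideal"
    using ug_ideal.add[OF ug_ideal_mult_right[OF 1] ug_ideal_mult_left[OF 2]] by simp
qed

instance
proof
  show "(0 :: ug) \<noteq> 1"
    by transfer (use one_notin_ug_ideal ug_ideal_uminus[of "-1"] in \<open>auto simp: ug_eq_def\<close>)
qed (transfer, simp add: ug_eq_def algebra_simps ug_ideal.zero)+

end

lift_definition ug_const :: "complex \<Rightarrow> ug" is tconst .
lift_definition ug_gen :: "gen \<Rightarrow> ug" is tgen .

text \<open>The extension to the universal enveloping algebra. It is defined through a chosen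
  representative; for representations the choice is irrelevant.\<close>

definition ug_eval :: "(gen \<Rightarrow> complex^'n^'n) \<Rightarrow> ug \<Rightarrow> complex^'n^'n" where
  "ug_eval \<rho> X = tensor_eval \<rho> (rep_ug X)"

lemma ug_eval_abs:
  assumes "preserves_bracket \<rho>"
  shows "ug_eval \<rho> (abs_ug p) = tensor_eval \<rho> p"
proof -
  have "ug_eq (rep_ug (abs_ug p)) p"
    by (rule Quotient3_rep_abs[OF Quotient3_ug]) (simp_all add: ug_eq_def ug_ideal.zero)
  then have "tensor_eval \<rho> (rep_ug (abs_ug p) - p) = 0"
    by (intro tensor_eval_ideal[OF assms]) (simp add: ug_eq_def)
  then show ?thesis by (simp add: ug_eval_def tensor_eval_diff)
qed

lemma ug_eval_hom:
  assumes "preserves_bracket \<rho>"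
  shows "ug_eval \<rho> (X + Y) = ug_eval \<rho> X + ug_eval \<rho> Y"
    and "ug_eval \<rho> (X * Y) = ug_eval \<rho> X ** ug_eval \<rho> Y"
    and "ug_eval \<rho> (ug_const c) = mat c"
    and "ug_eval \<rho> (ug_gen x) = \<rho> x"
proof -
  obtain p q where [simp]: "X = abs_ug p" "Y = abs_ug q"
    by (metis Quotient3_abs_rep[OF Quotient3_ug])
  show "ug_eval \<rho> (X + Y) = ug_eval \<rho> X + ug_eval \<rho> Y"
    by (simp add: plus_ug.abs_eq ug_eval_abs[OF assms] tensor_eval_add)
  show "ug_eval \<rho> (X * Y) = ug_eval \<rho> X ** ug_eval \<rho> Y"
    by (simp add: times_ug.abs_eq ug_eval_abs[OF assms] tensor_eval_mult)
qed (simp_all add: ug_const.abs_eq ug_gen.abs_eq ug_eval_abs[OF assms])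

section \<open>Global sections\<close>

text \<open>The even part is one-dimensional and abelian, so its enveloping algebra is the polynomial
  algebra in its basis element. It is included in the full enveloping algebra, and acts on smooth
  functions on the circle by complexified invariant vector fields: \<open>i\<close> times the basis element
  is the standard generator of the Lie algebra of the circle, so the basis element acts by
  \<open>-i\<close> times the invariant vector field.\<close>

definition ug0_incl :: "complex poly \<Rightarrow> ug" where
  "ug0_incl p = (\<Sum>k\<le>degree p. ug_const (coeff p k) * ug_gen GC ^ k)"

definition C_field :: "(circle \<Rightarrow> complex) \<Rightarrow> circle \<Rightarrow> complex" where
  "C_field f = (\<lambda>z. - \<i> * circle_field f z)"

definition ug0_act :: "complex poly \<Rightarrow> (circle \<Rightarrow> complex) \<Rightarrow> circle \<Rightarrow> complex" where
  "ug0_act p f = (\<lambda>z. \<Sum>k\<le>degree p. coeff p k * (C_field ^^ k) f z)"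

text \<open>The complexified global sections of the supergroup. Complex linearity is the case of
  constant polynomials in the last condition.\<close>

definition sections :: "(ug \<Rightarrow> circle \<Rightarrow> complex) set" where
  "sections = {\<phi>. (\<forall>X. smooth_circle (\<phi> X))
     \<and> (\<forall>X Y. \<phi> (X + Y) = \<phi> X + \<phi> Y)
     \<and> (\<forall>p X. \<phi> (ug0_incl p * X) = ug0_act p (\<phi> X))}"

definition section_scale ::
    "complex \<Rightarrow> (ug \<Rightarrow> circle \<Rightarrow> complex) \<Rightarrow> ug \<Rightarrow> circle \<Rightarrow> complex" where
  "section_scale c \<phi> = (\<lambda>X z. c * \<phi> X z)"

global_interpretation section_space: vector_space section_scale
  by standard (auto simp: section_scale_def fun_eq_iff algebra_simps)

definition section_seminorm :: "ug \<Rightarrow> (ug \<Rightarrow> circle \<Rightarrow> complex) \<Rightarrow> real" where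
  "section_seminorm X \<phi> = (SUP z. cmod (\<phi> X z))"

definition section_topology :: "(ug \<Rightarrow> circle \<Rightarrow> complex) topology" where
  "section_topology = topology_generated_by
     {{\<psi> \<in> sections. section_seminorm X (\<psi> - \<phi>) < \<epsilon>} | X \<phi> \<epsilon>. \<phi> \<in> sections \<and> 0 < \<epsilon>}"

lemma topspace_section_topology: "topspace section_topology = sections"
proof
  show "topspace section_topology \<subseteq> sections"
    unfolding section_topology_def topology_generated_by_topspace by blast
  show "sections \<subseteq> topspace section_topology"
  proof
    fix \<phi> assume \<phi>: "\<phi> \<in> sections"
    let ?B = "{\<psi> \<in> sections. section_seminorm 0 (\<psi> - \<phi>) < 1}"
    have "\<phi> \<in> ?B" using \<phi> by (simp add: section_seminorm_def)
    moreover have "?B \<in> {{\<psi> \<in> sections. section_seminorm X (\<psi> - \<phi>) < \<epsilon>} | X \<phi> \<epsilon>.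
        \<phi> \<in> sections \<and> 0 < \<epsilon>}"
      unfolding mem_Collect_eq
      by (rule exI[of _ "0 :: ug"], rule exI[of _ \<phi>], rule exI[of _ "1 :: real"]) (simp add: \<phi>)
    ultimately show "\<phi> \<in> topspace section_topology"
      unfolding section_topology_def topology_generated_by_topspace by (rule UnionI[rotated])
  qed
qed

section \<open>Representations and matrix coefficients\<close>

text \<open>The super vector space is \<open>complex^'n\<close> in a homogeneous basis; \<open>par i\<close> says that the
  \<open>i\<close>-th basis vector is odd.\<close>

record 'n srep =
  par :: "'n \<Rightarrow> bool"
  grp :: "circle \<Rightarrow> complex^'n^'n"
  alg :: "gen \<Rightarrow> complex^'n^'n"

definition is_srep :: "('n::finite) srep \<Rightarrow> bool" where
  "is_srep R \<longleftrightarrow>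
     grp R 1 = mat 1 \<and> (\<forall>s t. grp R (s * t) = grp R s ** grp R t) \<and> smooth_circle (grp R)
   \<and> (\<forall>t i j. par R i \<noteq> par R j \<longrightarrow> grp R t $ i $ j = 0)
   \<and> preserves_bracket (alg R)
   \<and> (\<forall>x i j. (par R i \<noteq> par R j) \<noteq> gen_odd x \<longrightarrow> alg R x $ i $ j = 0)
   \<and> ((\<lambda>s. grp R (circle_exp s)) has_vector_derivative (mat \<i> ** alg R GC)) (at 0)
   \<and> (\<forall>t x. grp R t ** alg R x = alg R x ** grp R t)"

definition matrix_coeff ::
    "('n::finite) srep \<Rightarrow> (complex^'n \<Rightarrow> complex) \<Rightarrow> complex^'n \<Rightarrow> ug \<Rightarrow> circle \<Rightarrow> complex" where
  "matrix_coeff R \<omega> v = (\<lambda>X g. \<omega> (grp R g *v (ug_eval (alg R) X *v v)))"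

definition matrix_coeffs :: "('n::finite) srep \<Rightarrow> (ug \<Rightarrow> circle \<Rightarrow> complex) set" where
  "matrix_coeffs R = {matrix_coeff R \<omega> v | \<omega> v. Vector_Spaces.linear (*s) (*) \<omega>}"

definition triv_rep :: "1 srep" where
  "triv_rep = \<lparr>par = (\<lambda>_. False), grp = (\<lambda>_. mat 1), alg = (\<lambda>_. 0)\<rparr>"

text \<open>In the two-dimensional representations the argument \<open>e\<close> says whether the first basis
  vector is odd; the second one has the opposite parity. The argument \<open>r\<close> is the chosen
  square root of \<open>-m\<close>.\<close>

definition weight_rep :: "bool \<Rightarrow> complex \<Rightarrow> int \<Rightarrow> 2 srep" where
  "weight_rep e r m = \<lparr>
     par = (\<lambda>i. if i = 1 then e else \<not> e),
     grp = (\<lambda>t. mat (of_circle t powi m)),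
     alg = (\<lambda>x. case x of
       GC \<Rightarrow> mat (of_int m)
     | GZ \<Rightarrow> vector [vector [0, r], vector [r, 0]])\<rparr>"

definition minus_rep :: "bool \<Rightarrow> 2 srep" where
  "minus_rep e = \<lparr>
     par = (\<lambda>i. if i = 1 then e else \<not> e),
     grp = (\<lambda>_. mat 1),
     alg = (\<lambda>x. case x of
       GC \<Rightarrow> 0
     | GZ \<Rightarrow> vector [vector [0, 0], vector [1, 0]])\<rparr>"

lemma smooth_circle_power:
  "smooth_circle (\<lambda>t. mat (of_circle t powi m) :: complex^'n^'n)"
  and has_vector_derivative_circle_power:
  "((\<lambda>s. mat (of_circle (circle_exp s) powi m) :: complex^'n^'n)
     has_vector_derivative (mat \<i> ** mat (of_int m))) (at 0)"
proof -
  let ?h = "\<lambda>d s. mat (d * exp (\<i> * of_int m * of_real s)) :: complex^'n^'n"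
  have e: "of_circle (circle_exp s) powi m = exp (\<i> * of_int m * of_real s)" for s
    by (simp add: circle_exp.rep_eq cis_power_int) (simp add: cis_conv_exp mult_ac)
  have bl: "bounded_linear (mat :: complex \<Rightarrow> complex^'n^'n)"
    by (intro linear_conv_bounded_linear[THEN iffD1] linearI)
       (simp_all add: mat_def vec_eq_iff)
  have d: "(?h d has_vector_derivative mat (d * (\<i> * of_int m) * exp (\<i> * of_int m * of_real s)))
      (at s)" for d s
    by (rule bounded_linear.has_vector_derivative[OF bl])
       (rule has_vector_derivative_real_field, auto intro!: derivative_eq_intros)
  have "((\<lambda>u s. vector_derivative u (at s)) ^^ k) (?h 1) = ?h ((\<i> * of_int m) ^ k)" for k
  proof (induction k)
    case (Suc k)
    have "(\<lambda>s. vector_derivative (?h c) (at s)) = ?h (c * (\<i> * of_int m))" for c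
      by (rule ext) (rule vector_derivative_at[OF d])
    then show ?case unfolding funpow.simps o_apply Suc.IH power_Suc2 .
  qed simp
  moreover have "?h c differentiable (at t)" for c t
    using d[of c t] by (rule differentiableI_vector)
  ultimately have "smooth_real (?h 1)" unfolding smooth_real_def by metis
  then show "smooth_circle (\<lambda>t. mat (of_circle t powi m) :: complex^'n^'n)"
    by (simp add: smooth_circle_def e)
  show "((\<lambda>s. mat (of_circle (circle_exp s) powi m) :: complex^'n^'n)
     has_vector_derivative (mat \<i> ** mat (of_int m))) (at 0)"
    using d[of 1 0] by (simp add: e mat_mult_mat)
qed

lemma is_srep_triv_rep: "is_srep triv_rep"
  using smooth_circle_power[where m = 0 and 'n = 1]
  by (auto simp: is_srep_def triv_rep_def preserves_bracket_def)

lemma is_srep_minus_rep: "is_srep (minus_rep e)"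
proof -
  have "preserves_bracket (alg (minus_rep e))"
    unfolding preserves_bracket_def
  proof (intro allI)
    fix x y
    show "alg (minus_rep e) x ** alg (minus_rep e) y
        - mat (koszul x y) ** alg (minus_rep e) y ** alg (minus_rep e) x
      = (\<Sum>k\<in>{GC, GZ}. mat (sbracket x y k) ** alg (minus_rep e) k)"
      by (cases x; cases y)
       (auto simp: minus_rep_def vec_eq_iff forall_2 sbracket_def koszul_def
         matrix_matrix_mult_def mat_def sum_2 vector_2)
  qed
  moreover have "alg (minus_rep e) x $ i $ j = 0"
    if "(par (minus_rep e) i \<noteq> par (minus_rep e) j) \<noteq> gen_odd x" for x i j
    using that exhaust_2[of i] exhaust_2[of j]
    by (cases x) (auto simp: minus_rep_def vector_2)
  ultimately show ?thesis
    using smooth_circle_power[where m = 0 and 'n = 2]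
    by (auto simp: is_srep_def minus_rep_def) (simp_all add: mat_def)
qed

lemma is_srep_weight_rep:
  assumes "r\<^sup>2 = - of_int m"
  shows "is_srep (weight_rep e r m)"
proof -
  have "preserves_bracket (alg (weight_rep e r m))"
    unfolding preserves_bracket_def
  proof (intro allI)
    fix x y
    show "alg (weight_rep e r m) x ** alg (weight_rep e r m) y
        - mat (koszul x y) ** alg (weight_rep e r m) y ** alg (weight_rep e r m) x
      = (\<Sum>k\<in>{GC, GZ}. mat (sbracket x y k) ** alg (weight_rep e r m) k)"
      using assms by (cases x; cases y)
       (auto simp: weight_rep_def vec_eq_iff forall_2 sbracket_def koszul_def
         matrix_matrix_mult_def mat_def sum_2 vector_2 power2_eq_square)
  qed
  moreover have "alg (weight_rep e r m) x $ i $ j = 0"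
    if "(par (weight_rep e r m) i \<noteq> par (weight_rep e r m) j) \<noteq> gen_odd x" for x i j
    using that exhaust_2[of i] exhaust_2[of j]
    by (cases x) (auto simp: weight_rep_def mat_def vector_2)
  ultimately show ?thesis
    using smooth_circle_power[where m = m and 'n = 2]
      has_vector_derivative_circle_power[where m = m and 'n = 2]
    by (auto simp: is_srep_def weight_rep_def one_circle.rep_eq times_circle.rep_eq
        power_int_mult_distrib mat_mult_mat intro: mat_commute) (simp_all add: mat_def)
qed

end

theory Submission
  imports Defs
begin

text \<open>Since \<open>Z\<^sup>2 = -C\<close> and \<open>C\<close> is central, every element of the enveloping algebra is
  \<open>P(C) + Q(C) Z\<close>, so a section \<open>\<phi>\<close> is determined by \<open>\<phi>(1)\<close> and \<open>\<phi>(Z)\<close>, and each seminorm of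
  \<open>\<phi>\<close> is controlled by finitely many derivatives of these two functions. The matrix coefficients
  of the given representations realise every pair of trigonometric polynomials: a weight
  \<open>m \<noteq> 0\<close> contributes \<open>(z\<^sup>m, 0)\<close> and \<open>(0, z\<^sup>m)\<close>, while \<open>(1, 0)\<close> comes from the trivial representation
  and \<open>(0, 1)\<close> needs \<open>\<pi>\<^sub>-\<close>. It remains to approximate a smooth function on the circle, together with
  finitely many derivatives, by trigonometric polynomials: apply Stone-Weierstrass to the highest
  derivative and integrate.\<close>

section \<open>Smooth functions on the circle\<close>

text \<open>\<open>vector_derivative\<close> is an arbitrary value where no derivative exists, so
  commuting it with \<open>L\<close> rests on differentiability; \<open>smooth_real\<close> supplies
  this at every order.\<close>

lemma higher_vector_derivative_bounded_linear:
  assumes L: "bounded_linear L" and h: "smooth_real h"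
  shows "((\<lambda>u s. vector_derivative u (at s)) ^^ k) (\<lambda>t. L (h t))
    = (\<lambda>t. L (((\<lambda>u s. vector_derivative u (at s)) ^^ k) h t))"
proof (induction k)
  case (Suc k)
  let ?u = "((\<lambda>u s. vector_derivative u (at s)) ^^ k) h"
  have "vector_derivative (\<lambda>t. L (?u t)) (at s) = L (vector_derivative ?u (at s))" for s
    using h vector_derivative_works unfolding smooth_real_def
    by (intro vector_derivative_at bounded_linear.has_vector_derivative[OF L]) blast
  then show ?case by (simp add: Suc.IH)
qed simp

lemma smooth_real_bounded_linear:
  assumes L: "bounded_linear L" and h: "smooth_real h"
  shows "smooth_real (\<lambda>t. L (h t))"
  unfolding smooth_real_def higher_vector_derivative_bounded_linear[OF assms]
proof (intro allI)
  fix k t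
  let ?u = "((\<lambda>u s. vector_derivative u (at s)) ^^ k) h"
  have "(?u has_vector_derivative vector_derivative ?u (at t)) (at t)"
    using h unfolding smooth_real_def vector_derivative_works by blast
  then show "(\<lambda>t. L (?u t)) differentiable (at t)"
    by (intro differentiableI_vector[OF bounded_linear.has_vector_derivative[OF L]])
qed

lemma higher_vector_derivative_add:
  assumes f: "smooth_real f" and g: "smooth_real g"
  shows "((\<lambda>u s. vector_derivative u (at s)) ^^ k) (\<lambda>t. f t + g t)
    = (\<lambda>t. ((\<lambda>u s. vector_derivative u (at s)) ^^ k) f t
        + ((\<lambda>u s. vector_derivative u (at s)) ^^ k) g t)"
proof (induction k)
  case (Suc k)
  then show ?case using f g unfolding smooth_real_def by simp
qed simp

lemma smooth_real_add:
  assumes "smooth_real f" and "smooth_real g"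
  shows "smooth_real (\<lambda>t. f t + g t)"
  unfolding smooth_real_def higher_vector_derivative_add[OF assms]
  using assms unfolding smooth_real_def by simp

lemma smooth_real_vector_derivative:
  "smooth_real h \<Longrightarrow> smooth_real (\<lambda>s. vector_derivative h (at s))"
  unfolding smooth_real_def
  by (metis (no_types, lifting) comp_apply funpow_Suc_right)

section \<open>The covering of the circle by the real line\<close>

lemma circle_exp_add: "circle_exp (s + t) = circle_exp s * circle_exp t"
  by transfer (simp add: cis_mult)

lemma circle_exp_2pi: "circle_exp (2 * pi) = circle_exp 0"
  by transfer simp

text \<open>Keeping the parameter in one period gives a compact interval for boundedness and the
  length bound 2 * pi for mean value estimates.\<close>

lemma circle_exp_cases:
  obtains t where "t \<in> {0..2 * pi}" "z = circle_exp t"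
proof -
  have "circle_exp (Arg2pi (of_circle z)) = z"
  proof transfer
    fix z :: complex assume "cmod z = 1"
    then show "cis (Arg2pi z) = z" by (metis cis_conv_exp complex_norm_eq_1_exp)
  qed
  then show thesis
    using Arg2pi[of "of_circle z"] by (intro that[of "Arg2pi (of_circle z)"]) auto
qed

lemma smooth_circle_bounded_linear:
  "bounded_linear L \<Longrightarrow> smooth_circle f \<Longrightarrow> smooth_circle (\<lambda>z. L (f z))"
  unfolding smooth_circle_def by (rule smooth_real_bounded_linear)

lemma smooth_circle_add: "smooth_circle f \<Longrightarrow> smooth_circle g \<Longrightarrow> smooth_circle (\<lambda>z. f z + g z)"
  unfolding smooth_circle_def by (simp add: smooth_real_add)

lemma smooth_circle_mult: "smooth_circle f \<Longrightarrow> smooth_circle (\<lambda>z. c * f z :: complex)"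
  by (rule smooth_circle_bounded_linear[OF bounded_linear_mult_right])

lemma smooth_circle_diff:
  fixes f :: "circle \<Rightarrow> complex"
  shows "smooth_circle f \<Longrightarrow> smooth_circle g \<Longrightarrow> smooth_circle (\<lambda>z. f z - g z)"
  using smooth_circle_add[OF _ smooth_circle_mult, of f g "-1"] by simp

lemma smooth_circle_char: "smooth_circle (\<lambda>z. c * of_circle z powi m)"
proof -
  \<comment> \<open>The scalar claim is read off from \<open>smooth_circle_power\<close> for one by
    one matrices, whose single entry is a bounded linear functional.\<close>
  have "bounded_linear (\<lambda>M :: complex^1^1. c * M $ 1 $ 1)"
    by (intro linear_conv_bounded_linear[THEN iffD1] linearI) (simp_all add: algebra_simps)
  from smooth_circle_bounded_linear[OF this smooth_circle_power] show ?thesis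
    by (simp add: mat_def)
qed

lemma smooth_circle_const: "smooth_circle (\<lambda>_. c :: complex)"
  using smooth_circle_char[of c 0] by simp

section \<open>The derivation \<open>C_field\<close> and its iterates\<close>

text \<open>\<open>circle_exp\<close> is a homomorphism, so translation on the circle is a shift of
  the real parameter. Being an equivalence for each \<open>d\<close>, it also matches the choice
  hidden in \<open>vector_derivative\<close>, which identifies \<open>circle_field\<close> with the
  derivative of the pullback.\<close>

lemma has_vector_derivative_circle_exp_iff:
  "((\<lambda>s. f (circle_exp t * circle_exp s)) has_vector_derivative d) (at 0)
    \<longleftrightarrow> ((\<lambda>s. f (circle_exp s)) has_vector_derivative d) (at t)"
proof
  assume "((\<lambda>s. f (circle_exp s)) has_vector_derivative d) (at t)"
  moreover have "((\<lambda>s. t + s) has_vector_derivative 1) (at 0)"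
    by (auto intro!: derivative_eq_intros)
  ultimately show "((\<lambda>s. f (circle_exp t * circle_exp s)) has_vector_derivative d) (at 0)"
    using vector_diff_chain_at[of "\<lambda>s. t + s" 1 0 "\<lambda>s. f (circle_exp s)" d]
    by (simp add: o_def circle_exp_add)
next
  assume "((\<lambda>s. f (circle_exp t * circle_exp s)) has_vector_derivative d) (at 0)"
  moreover have "((\<lambda>s. s - t) has_vector_derivative 1) (at t)"
    by (auto intro!: derivative_eq_intros)
  ultimately show "((\<lambda>s. f (circle_exp s)) has_vector_derivative d) (at t)"
    using vector_diff_chain_at[of "\<lambda>s. s - t" 1 t "\<lambda>s. f (circle_exp t * circle_exp s)" d]
    by (simp add: o_def circle_exp_add[symmetric])
qed

lemma circle_field_circle_exp:
  "circle_field f (circle_exp t) = vector_derivative (\<lambda>s. f (circle_exp s)) (at t)"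
  unfolding circle_field_def vector_derivative_def has_vector_derivative_circle_exp_iff ..

lemma smooth_circle_has_vector_derivative:
  assumes "smooth_circle f"
  shows "((\<lambda>s. f (circle_exp s)) has_vector_derivative \<i> * C_field f (circle_exp t)) (at t)"
proof -
  have "(\<lambda>s. f (circle_exp s)) differentiable (at t)"
    using assms unfolding smooth_circle_def smooth_real_def by (auto dest: spec[of _ 0])
  then show ?thesis
    by (simp add: C_field_def circle_field_circle_exp vector_derivative_works)
qed

text \<open>The factor -\<i> in \<open>C_field\<close> cancels the \<i> here, and every point of the
  circle is some \<open>circle_exp t\<close>.\<close>

lemma C_field_eqI:
  assumes "\<And>t. ((\<lambda>s. f (circle_exp s)) has_vector_derivative \<i> * g (circle_exp t)) (at t)"
  shows "C_field f = g"
proof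
  fix z
  obtain t where "z = circle_exp t" by (rule circle_exp_cases)
  then show "C_field f z = g z"
    using vector_derivative_at[OF assms[of t]] by (simp add: C_field_def circle_field_circle_exp)
qed

lemma C_field_add:
  assumes "smooth_circle f" "smooth_circle g"
  shows "C_field (\<lambda>z. f z + g z) = (\<lambda>z. C_field f z + C_field g z)"
proof (rule C_field_eqI)
  fix t
  show "((\<lambda>s. f (circle_exp s) + g (circle_exp s)) has_vector_derivative
      \<i> * (C_field f (circle_exp t) + C_field g (circle_exp t))) (at t)"
    unfolding distrib_left
    by (intro has_vector_derivative_add smooth_circle_has_vector_derivative[of f]
        smooth_circle_has_vector_derivative[of g] assms)
qed

lemma C_field_mult:
  assumes "smooth_circle f"
  shows "C_field (\<lambda>z. c * f z) = (\<lambda>z. c * C_field f z)"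
proof (rule C_field_eqI)
  fix t
  show "((\<lambda>s. c * f (circle_exp s)) has_vector_derivative \<i> * (c * C_field f (circle_exp t))) (at t)"
    using bounded_linear.has_vector_derivative[OF bounded_linear_mult_right
        smooth_circle_has_vector_derivative[OF assms], of c t]
    by (simp add: mult_ac)
qed

lemma C_field_const: "C_field (\<lambda>_. c) = (\<lambda>_. 0)"
  by (rule C_field_eqI) simp

lemma smooth_circle_C_field: "smooth_circle f \<Longrightarrow> smooth_circle (C_field f)"
  unfolding smooth_circle_def C_field_def circle_field_circle_exp
  by (intro smooth_real_bounded_linear[OF bounded_linear_mult_right] smooth_real_vector_derivative)

lemma smooth_circle_C_field_funpow: "smooth_circle f \<Longrightarrow> smooth_circle ((C_field ^^ k) f)"
  by (induction k) (auto intro: smooth_circle_C_field)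

lemma C_field_funpow_add:
  assumes "smooth_circle f" "smooth_circle g"
  shows "(C_field ^^ k) (\<lambda>z. f z + g z) = (\<lambda>z. (C_field ^^ k) f z + (C_field ^^ k) g z)"
  by (induction k) (simp_all add: C_field_add smooth_circle_C_field_funpow assms)

lemma C_field_funpow_mult:
  assumes "smooth_circle f"
  shows "(C_field ^^ k) (\<lambda>z. c * f z) = (\<lambda>z. c * (C_field ^^ k) f z)"
  by (induction k) (simp_all add: C_field_mult smooth_circle_C_field_funpow assms)

lemma C_field_funpow_diff:
  assumes "smooth_circle f" "smooth_circle g"
  shows "(C_field ^^ k) (\<lambda>z. f z - g z) = (\<lambda>z. (C_field ^^ k) f z - (C_field ^^ k) g z)"
  using C_field_funpow_add[OF assms(1) smooth_circle_mult[OF assms(2)], of k "-1"]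
    C_field_funpow_mult[OF assms(2), of k "-1"] by simp

lemma cmod_C_field_funpow_const: "cmod ((C_field ^^ k) (\<lambda>_. c) z) \<le> cmod c"
proof -
  \<comment> \<open>The first application already annihilates a constant, so only k = 0 retains
    \<open>c\<close>.\<close>
  have "(C_field ^^ Suc k) (\<lambda>_. c) = (\<lambda>_. 0)" for k
    by (induction k) (simp_all add: C_field_const)
  then show ?thesis by (cases k) simp_all
qed

section \<open>Continuity and boundedness of smooth functions\<close>

lemma continuous_smooth_circle:
  assumes "smooth_circle f"
  shows "isCont (\<lambda>s. f (circle_exp s)) t"
  using assms unfolding smooth_circle_def smooth_real_def
  by (metis differentiable_imp_continuous_within funpow_0)

text \<open>A supremum in \<open>section_seminorm\<close> dominates the pointwise values only when
  these are bounded; compactness of one period gives the bound.\<close>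

lemma bdd_above_smooth_circle:
  assumes "smooth_circle f"
  shows "bdd_above (range (\<lambda>z. norm (f z)))"
proof -
  have "compact ((\<lambda>t. f (circle_exp t)) ` {0..2 * pi})"
    by (intro compact_continuous_image continuous_at_imp_continuous_on ballI
        continuous_smooth_circle assms) simp
  then obtain B where B: "\<And>t. t \<in> {0..2 * pi} \<Longrightarrow> norm (f (circle_exp t)) \<le> B"
    unfolding bounded_iff[of "_ ` _"] using compact_imp_bounded bounded_iff by (metis imageI)
  show ?thesis
    by (rule bdd_aboveI[of _ B]) (metis B circle_exp_cases imageE)
qed

section \<open>Approximation by trigonometric polynomials\<close>

inductive_set trig_polys :: "(circle \<Rightarrow> complex) set" where
  char: "(\<lambda>z. c * of_circle z powi m) \<in> trig_polys"
| add: "p \<in> trig_polys \<Longrightarrow> q \<in> trig_polys \<Longrightarrow> (\<lambda>z. p z + q z) \<in> trig_polys"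

lemma trig_polys_const: "(\<lambda>_. c) \<in> trig_polys"
  using trig_polys.char[of c 0] by simp

lemma trig_polys_mult:
  assumes "p \<in> trig_polys" "q \<in> trig_polys"
  shows "(\<lambda>z. p z * q z) \<in> trig_polys"
  using assms(1)
proof (induction rule: trig_polys.induct)
  case (char c m)
  show ?case
    using assms(2)
  proof (induction rule: trig_polys.induct)
    case (char d n)
    have "c * of_circle z powi m * (d * of_circle z powi n)
        = (c * d) * of_circle z powi (m + n)" for z
    proof -
      have "of_circle z \<noteq> 0" using of_circle[of z] by auto
      then show ?thesis by (simp add: power_int_add mult_ac)
    qed
    then show ?case using trig_polys.char[of "c * d" "m + n"] by (simp only:)
  next
    case (add p q)
    then show ?case unfolding distrib_left by (intro trig_polys.add[of "\<lambda>z. _ z * p z"])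
  qed
next
  case (add p p')
  then show ?case unfolding distrib_right by (intro trig_polys.add[of "\<lambda>z. p z * q z"])
qed

lemma smooth_circle_trig_polys: "p \<in> trig_polys \<Longrightarrow> smooth_circle p"
  by (induction rule: trig_polys.induct) (auto intro: smooth_circle_char smooth_circle_add)

lemma C_field_char:
  "C_field (\<lambda>z. c * of_circle z powi m) = (\<lambda>z. c * of_int m * of_circle z powi m)"
proof (rule C_field_eqI)
  fix t
  have e: "of_circle (circle_exp s) powi m = exp (\<i> * of_int m * of_real s)" for s
    by (simp add: circle_exp.rep_eq cis_power_int) (simp add: cis_conv_exp mult_ac)
  show "((\<lambda>s. c * of_circle (circle_exp s) powi m) has_vector_derivative
      \<i> * (c * of_int m * of_circle (circle_exp t) powi m)) (at t)"
    unfolding e by (rule has_vector_derivative_real_field) (auto intro!: derivative_eq_intros)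
qed

text \<open>\<open>C_field\<close> multiplies the character of weight m by m. Nonzero weights can
  therefore be divided by m, while the weight 0 part has no primitive and is split off as
  \<open>c\<close>.\<close>

lemma trig_polys_primitive:
  assumes "q \<in> trig_polys"
  obtains c Q where "Q \<in> trig_polys" "q = (\<lambda>z. c + C_field Q z)"
  using assms
proof (induction arbitrary: thesis rule: trig_polys.induct)
  case (char c m)
  show ?case
  proof (cases "m = 0")
    case True
    then show ?thesis
      by (intro char[of "\<lambda>_. 0" c]) (auto simp: trig_polys_const C_field_const)
  next
    case False
    then show ?thesis
      using C_field_char[of "c / of_int m" m]
      by (intro char[OF trig_polys.char[of "c / of_int m" m], of 0]) simp
  qed
next
  case (add p q)
  obtain c P d Q where *: "P \<in> trig_polys" "p = (\<lambda>z. c + C_field P z)"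
    "Q \<in> trig_polys" "q = (\<lambda>z. d + C_field Q z)"
    using add.IH by metis
  then have "(\<lambda>z. p z + q z) = (\<lambda>z. (c + d) + C_field (\<lambda>z. P z + Q z) z)"
    by (simp add: C_field_add smooth_circle_trig_polys fun_eq_iff)
  then show ?case using * by (intro add.prems[OF trig_polys.add[of P Q], of "c + d"]) auto
qed

text \<open>On the unit circle conjugation is inversion, so real and imaginary parts, and with them
  all real linear functionals, combine the weights 1 and -1. Constants, sums and products follow by
  closure.\<close>

lemma real_polynomial_trig_polys:
  assumes "real_polynomial_function p"
  shows "(\<lambda>z. complex_of_real (p (of_circle z))) \<in> trig_polys"
  using assms
proof (induction rule: real_polynomial_function.induct)
  case (linear p)
  have p: "p w = Re w * p 1 + Im w * p \<i>" for w
  proof -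
    have "w = Re w *\<^sub>R 1 + Im w *\<^sub>R \<i>" by (simp add: complex_eq_iff)
    then have "p w = p (Re w *\<^sub>R 1 + Im w *\<^sub>R \<i>)" by (rule arg_cong)
    then show ?thesis
      using linear by (simp add: bounded_linear.linear linear_add linear_scale)
  qed
  have *: "complex_of_real (p (of_circle z)) = (p 1 - \<i> * p \<i>) / 2 * of_circle z powi 1
      + (p 1 + \<i> * p \<i>) / 2 * of_circle z powi (- 1)" for z
  proof -
    have "cmod (of_circle z) = 1" using of_circle by simp
    then have "inverse (of_circle z) = cnj (of_circle z)"
      by (metis complex_norm_square inverse_unique of_real_1 power_one)
    then have "of_circle z powi - 1 = cnj (of_circle z)" by (simp add: power_int_minus)
    then show ?thesis
      unfolding p[of "of_circle z"] power_int_1_right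
      by (simp only:) (simp add: complex_eq_iff field_simps)
  qed
  show ?case
    using trig_polys.add[OF trig_polys.char[of "(p 1 - \<i> * p \<i>) / 2" 1]
        trig_polys.char[of "(p 1 + \<i> * p \<i>) / 2" "-1"]]
    unfolding * .
next
  case (add f g)
  from trig_polys.add[OF add.IH] show ?case by simp
next
  case (mult f g)
  from trig_polys_mult[OF mult.IH] show ?case by simp
qed (simp add: trig_polys_const)

section \<open>Uniform approximation by Stone-Weierstrass\<close>

text \<open>Stone-Weierstrass asks for continuity on a compact set in the plane, whereas smoothness
  is known along the covering. Continuous local branches of the argument connect the two.\<close>

lemma continuous_on_sphere_smooth_circle:
  assumes "smooth_circle f"
  shows "continuous_on (sphere 0 1) (\<lambda>w. f (Circle w))"
proof -
  have c: "continuous (at w) (\<lambda>w. f (circle_exp (g w)))" if "continuous (at w) g" for w g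
    using that continuous_smooth_circle[OF assms] by (rule isCont_o2)
  have 1: "f (circle_exp (Arg w)) = f (Circle w)" if "w \<in> sphere 0 1" for w
  proof -
    have "w = cis (Arg w)"
      using that by (metis cis_Arg div_by_1 dist_0_norm mem_sphere norm_zero of_real_1 sgn_eq
          zero_neq_one)
    then show ?thesis by (metis circle_exp.abs_eq)
  qed
  \<comment> \<open>\<open>Arg\<close> jumps on the nonpositive axis; there
    \<open>Arg (- w) + pi\<close> is a continuous branch and parametrises the same point, because
    cis pi = -1.\<close>
  have 2: "f (circle_exp (Arg (- w) + pi)) = f (Circle w)" if "w \<in> sphere 0 1" for w
  proof -
    have "- w = cis (Arg (- w))"
      using that by (metis cis_Arg div_by_1 dist_0_norm mem_sphere norm_zero of_real_1 sgn_eq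
          zero_neq_one norm_minus_cancel)
    then have "w = cis (Arg (- w) + pi)" by (metis cis_mult cis_pi mult_minus1_right minus_minus)
    then show ?thesis by (metis circle_exp.abs_eq)
  qed
  show ?thesis
    unfolding continuous_on_eq_continuous_within
  proof
    fix w :: complex assume w: "w \<in> sphere 0 1"
    show "continuous (at w within sphere 0 1) (\<lambda>w. f (Circle w))"
    proof (cases "w \<in> \<real>\<^sub>\<le>\<^sub>0")
      case False
      from continuous_at_imp_continuous_at_within[OF c[OF continuous_at_Arg[OF this]]]
      show ?thesis by (rule continuous_transform_within[OF _ zero_less_one w]) (use 1 in auto)
    next
      case True
      then have "- w \<notin> \<real>\<^sub>\<le>\<^sub>0" using w by (auto simp: complex_nonpos_Reals_iff complex_eq_iff cmod_def)
      then have "continuous (at w) (\<lambda>w. Arg (- w) + pi)"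
        by (intro continuous_intros isCont_o2[OF _ continuous_at_Arg])
      from continuous_at_imp_continuous_at_within[OF c[OF this]]
      show ?thesis by (rule continuous_transform_within[OF _ zero_less_one w]) (use 2 in auto)
    qed
  qed
qed

lemma trig_polys_dense_uniform:
  assumes "smooth_circle f" "0 < \<epsilon>"
  obtains q where "q \<in> trig_polys" "\<And>z. cmod (f z - q z) < \<epsilon>"
proof -
  obtain g where g: "polynomial_function g"
      "\<And>w. w \<in> sphere 0 1 \<Longrightarrow> cmod (f (Circle w) - g w) < \<epsilon>"
    using Stone_Weierstrass_polynomial_function[OF compact_sphere
        continuous_on_sphere_smooth_circle[OF assms(1)] assms(2)] by blast
  \<comment> \<open>Real and imaginary parts are real polynomial functions, so they are converted
    separately and recombined.\<close>
  let ?q = "\<lambda>z. complex_of_real (Re (g (of_circle z))) + \<i> * complex_of_real (Im (g (of_circle z)))"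
  have "real_polynomial_function (\<lambda>w. Re (g w))" "real_polynomial_function (\<lambda>w. Im (g w))"
    using g(1) bounded_linear_Re bounded_linear_Im unfolding polynomial_function_def
    by (auto simp: o_def)
  then have "?q \<in> trig_polys"
    by (intro trig_polys.add[of "\<lambda>z. of_real (Re (g (of_circle z)))"]
        trig_polys_mult[OF trig_polys_const] real_polynomial_trig_polys)
  moreover have "cmod (f z - ?q z) < \<epsilon>" for z
    using g(2)[of "of_circle z"] of_circle[of z]
    by (simp add: of_circle_inverse complex_eq[symmetric])
  ultimately show thesis by (rule that)
qed

section \<open>Simultaneous approximation of derivatives\<close>

text \<open>This form of the mean value inequality serves twice below: to bound the constant term of
  \<open>q\<close>, and to bound \<open>f - Q\<close> up to its value at one point.\<close>

lemma norm_diff_le_vector_derivative: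
  fixes f :: "real \<Rightarrow> 'a :: real_normed_vector"
  assumes "\<And>s. (f has_vector_derivative d s) (at s)" "\<And>s. norm (d s) \<le> B"
  shows "norm (f b - f a) \<le> B * \<bar>b - a\<bar>"
  unfolding real_norm_def[symmetric]
proof (rule differentiable_bound[OF convex_UNIV])
  fix s
  show "(f has_derivative (\<lambda>h. h *\<^sub>R d s)) (at s within UNIV)"
    using assms(1)[of s] by (simp add: has_vector_derivative_def)
  show "onorm (\<lambda>h. h *\<^sub>R d s) \<le> B"
    by (rule onorm_le) (use assms(2)[of s] in \<open>simp add: mult.commute[of B] mult_left_mono\<close>)
qed auto

text \<open>The antiderivative of an approximation of the derivative approximates the function after its
  constant term has been dropped; that term is small because the function is periodic.\<close>

lemma trig_polys_dense:
  assumes "smooth_circle f" "0 < \<epsilon>"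
  shows "\<exists>q\<in>trig_polys. \<forall>k\<le>N. \<forall>z. cmod ((C_field ^^ k) (\<lambda>z. f z - q z) z) \<le> \<epsilon>"
  using assms
proof (induction N arbitrary: f \<epsilon>)
  case 0
  from trig_polys_dense_uniform[OF this]
  obtain q where "q \<in> trig_polys" "\<And>z. cmod (f z - q z) < \<epsilon>" by metis
  then show ?case by (intro bexI[of _ q]) (simp_all add: less_imp_le)
next
  case (Suc N)
  \<comment> \<open>First derivatives of the remainder will be at most 2 * \<delta>, one \<delta>
    from the approximation and one from its constant term, and parameters differ by at most 2 * pi.
    The choice makes 2 * \<delta> * (2 * pi) + 2 * \<delta> equal to \<epsilon>, so both summands
    fit below \<epsilon>.\<close>
  define \<delta> where "\<delta> = \<epsilon> / (2 * (2 * pi + 1))"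
  have \<delta>: "0 < \<delta>" using Suc.prems(2) pi_gt_zero by (simp add: \<delta>_def add_pos_pos)
  have "0 < 2 * (2 * pi + 1)" using pi_gt_zero by (simp add: add_pos_pos)
  then have "\<delta> * (2 * (2 * pi + 1)) = \<epsilon>" by (simp add: \<delta>_def del: distrib_left_numeral)
  then have \<epsilon>: "2 * \<delta> * (2 * pi) + 2 * \<delta> = \<epsilon>" by (simp add: algebra_simps)
  have \<delta>_le: "2 * \<delta> \<le> \<epsilon>" using \<epsilon> mult_pos_pos[OF \<delta> pi_gt_zero] by linarith
  obtain q where q: "q \<in> trig_polys"
      "\<And>k z. k \<le> N \<Longrightarrow> cmod ((C_field ^^ k) (\<lambda>z. C_field f z - q z) z) \<le> \<delta>"
    using Suc.IH[OF smooth_circle_C_field[OF Suc.prems(1)] \<delta>] by blast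
  from q(1) obtain c Q where Q: "Q \<in> trig_polys" "q = (\<lambda>z. c + C_field Q z)"
    by (rule trig_polys_primitive)
  let ?h = "\<lambda>z. f z - Q z"
  note [simp] = smooth_circle_trig_polys[OF Q(1)] smooth_circle_trig_polys[OF q(1)]
    Suc.prems(1) smooth_circle_diff smooth_circle_C_field smooth_circle_const
  have Ch: "C_field ?h = (\<lambda>z. (C_field f z - q z) + c)"
    using C_field_funpow_diff[of f Q 1] Q(2) by simp
  \<comment> \<open>Subtracting \<open>\<i> * c * s\<close> removes the constant from the derivative
    and leaves \<i> times \<open>C_field f - q\<close>, of size at most \<delta>. Over a full period
    \<open>?h\<close> returns to its value, so 2 * pi times the modulus of \<open>c\<close> is at
    most 2 * pi * \<delta>.\<close>
  have "cmod (?h (circle_exp (2 * pi)) - \<i> * c * of_real (2 * pi)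
      - (?h (circle_exp 0) - \<i> * c * of_real 0)) \<le> \<delta> * \<bar>2 * pi - 0\<bar>"
  proof (rule norm_diff_le_vector_derivative)
    fix t
    have "((\<lambda>s. \<i> * c * complex_of_real s) has_vector_derivative \<i> * c) (at t)"
      by (rule has_vector_derivative_real_field) (auto intro!: derivative_eq_intros)
    moreover have "((\<lambda>s. ?h (circle_exp s)) has_vector_derivative
        \<i> * C_field ?h (circle_exp t)) (at t)"
      by (rule smooth_circle_has_vector_derivative[of ?h]) simp
    ultimately show "((\<lambda>s. ?h (circle_exp s) - \<i> * c * complex_of_real s) has_vector_derivative
        \<i> * C_field ?h (circle_exp t) - \<i> * c) (at t)"
      by (rule has_vector_derivative_diff[rotated])
    show "cmod (\<i> * C_field ?h (circle_exp t) - \<i> * c) \<le> \<delta>"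
      using q(2)[of 0 "circle_exp t"] by (simp add: Ch right_diff_distrib[symmetric] norm_mult)
  qed
  then have c: "cmod c \<le> \<delta>"
    using pi_gt_zero by (simp add: circle_exp_2pi norm_mult)
  have higher: "cmod ((C_field ^^ k) (C_field ?h) z) \<le> 2 * \<delta>" if "k \<le> N" for k z
  proof -
    have "(C_field ^^ k) (C_field ?h) z
        = (C_field ^^ k) (\<lambda>z. C_field f z - q z) z + (C_field ^^ k) (\<lambda>_. c) z"
      unfolding Ch by (subst C_field_funpow_add[of "\<lambda>z. C_field f z - q z" "\<lambda>_. c"]) simp_all
    moreover have "cmod ((C_field ^^ k) (\<lambda>_. c) z) \<le> \<delta>"
      using cmod_C_field_funpow_const c by (rule order_trans)
    ultimately show ?thesis
      using norm_triangle_mono[OF q(2)[OF that, of z], of "(C_field ^^ k) (\<lambda>_. c) z" \<delta>] by simp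
  qed
  \<comment> \<open>The added constant makes \<open>f - ?R\<close> vanish at
    \<open>circle_exp 0\<close>, where the mean value estimate starts; derivatives of positive order
    do not see it.\<close>
  let ?R = "\<lambda>z. Q z + ?h (circle_exp 0)"
  have R: "(C_field ^^ k) (\<lambda>z. f z - ?R z) = (\<lambda>z. (C_field ^^ k) ?h z - (C_field ^^ k) (\<lambda>_. ?h (circle_exp 0)) z)"
    for k
    using C_field_funpow_diff[of ?h "\<lambda>_. ?h (circle_exp 0)" k]
    by (simp add: diff_diff_eq)
  have zero: "cmod (f z - ?R z) \<le> \<epsilon>" for z
  proof -
    obtain t where t: "t \<in> {0..2 * pi}" "z = circle_exp t" by (rule circle_exp_cases)
    have "((\<lambda>s. ?h (circle_exp s)) has_vector_derivative \<i> * C_field ?h (circle_exp s)) (at s)" for s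
      by (rule smooth_circle_has_vector_derivative[of ?h]) simp
    moreover have "cmod (\<i> * C_field ?h (circle_exp s)) \<le> 2 * \<delta>" for s
      using higher[of 0 "circle_exp s"] by (simp add: norm_mult)
    ultimately have "cmod (?h (circle_exp t) - ?h (circle_exp 0)) \<le> 2 * \<delta> * \<bar>t - 0\<bar>"
      by (rule norm_diff_le_vector_derivative[of "\<lambda>s. ?h (circle_exp s)"])
    also have "\<dots> \<le> 2 * \<delta> * (2 * pi)" using t(1) \<delta> by (intro mult_left_mono) auto
    also have "\<dots> \<le> \<epsilon>" using \<epsilon> \<delta> by linarith
    finally show ?thesis by (simp add: t(2) algebra_simps)
  qed
  have "cmod ((C_field ^^ k) (\<lambda>z. f z - ?R z) z) \<le> \<epsilon>" if "k \<le> Suc N" for k z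
  proof (cases k)
    case 0
    then show ?thesis using zero by simp
  next
    case (Suc j)
    have "(C_field ^^ k) (\<lambda>z. f z - ?R z) z = (C_field ^^ j) (C_field ?h) z"
      \<comment> \<open>With both scalars 0 this says that iterates of \<open>C_field\<close> fix
        the zero function, which is what the constant becomes after one derivative.\<close>
      using C_field_funpow_mult[OF smooth_circle_const, of j 0 0]
      unfolding R unfolding Suc funpow_Suc_right by (simp add: C_field_const)
    then show ?thesis
      using order_trans[OF higher \<delta>_le] that Suc by simp
  qed
  moreover have "?R \<in> trig_polys" using Q(1) trig_polys_const by (rule trig_polys.add)
  ultimately show ?case by (intro bexI[of _ ?R] allI impI)
qed

section \<open>Normal form in the enveloping algebra\<close>

lemma tconst_commute: "tconst c * p = p * tconst c"
  by (induction p rule: tensor_induct)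
     (simp_all add: tconst_def mult_single mult.commute distrib_left distrib_right)

lemma ug_const_commute: "ug_const c * X = X * ug_const c"
  by transfer (simp add: tconst_commute ug_eq_def ug_ideal.zero)

lemma ug_const_add: "ug_const (c + d) = ug_const c + ug_const d"
  by transfer (simp add: tconst_def single_add ug_eq_def ug_ideal.zero)

lemma ug_const_0 [simp]: "ug_const 0 = 0"
  by transfer (simp add: tconst_def ug_eq_def ug_ideal.zero)

lemma ug_const_1 [simp]: "ug_const 1 = 1"
  by transfer (simp add: tconst_def ug_eq_def ug_ideal.zero)

lemma ug_gen_Z_C: "ug_gen GZ * ug_gen GC = ug_gen GC * ug_gen GZ"
proof -
  have "tgen GC * tgen GZ - tgen GZ * tgen GC \<in> ug_ideal"
    using ug_ideal.relator[of 1 GC GZ 1]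
    by (simp add: ug_relator_def koszul_def sbracket_def tconst_def)
  then have "ug_gen GC * ug_gen GZ = ug_gen GZ * ug_gen GC"
    by transfer (simp add: ug_eq_def)
  then show ?thesis by simp
qed

text \<open>For two odd arguments the supercommutator is an anticommutator, so the relator is 2 (Z Z
  + C); the scalar 2 is invertible and the ideal absorbs 1/2.\<close>

lemma ug_gen_Z_Z: "ug_gen GZ * ug_gen GZ = - ug_gen GC"
proof -
  let ?Z = "tgen GZ" and ?C = "tgen GC"
  have half: "tconst (1 / 2) * (tconst 2 * p) = p" for p
  proof -
    have "tconst (1 / 2) * tconst 2 = 1"
      by (simp only: tconst_def mult_single) simp
    then show ?thesis by (simp add: mult.assoc[symmetric])
  qed
  have [simp]: "tconst (- c) = - tconst c" for c by (simp add: tconst_def single_uminus)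
  have [simp]: "tconst 1 = 1" "tconst 0 = 0" by (simp_all add: tconst_def)
  have two: "tconst 2 = 1 + 1" by (simp add: tconst_def single_add[symmetric] flip: single_one)
  have "ug_relator GZ GZ = tconst 2 * (?Z * ?Z + ?C)"
    by (simp add: ug_relator_def koszul_def sbracket_def) (simp add: two algebra_simps mult_2)
  then have "?Z * ?Z + ?C \<in> ug_ideal"
    using ug_ideal.relator[of "tconst (1 / 2)" GZ GZ 1] by (simp add: half)
  then show ?thesis by transfer (simp add: ug_eq_def)
qed

text \<open>Each tensor is a finite sum of scaled words, and a word grows on the left by one
  generator at a time, its coefficient being carried by the empty word.\<close>

lemma ug_induct [case_names const gen add]:
  assumes "\<And>c. P (ug_const c)" and gen: "\<And>x X. P X \<Longrightarrow> P (ug_gen x * X)"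
    and "\<And>X Y. P X \<Longrightarrow> P Y \<Longrightarrow> P (X + Y)"
  shows "P X"
proof -
  have "P (abs_ug p)" for p
  proof (induction p rule: tensor_induct)
    case (single w c)
    have "P (abs_ug (Poly_Mapping.single (Word xs) c))" for xs
    proof (induction xs)
      case Nil
      show ?case
        using assms(1)[of c] by (simp add: ug_const.abs_eq tconst_def zero_word_def)
    next
      case (Cons x xs)
      then show ?case
        using gen[of "abs_ug (Poly_Mapping.single (Word xs) c)" x]
        by (simp add: ug_gen.abs_eq times_ug.abs_eq tgen_def mult_single plus_word_def)
    qed
    then show ?case by (metis word.exhaust)
  next
    case (add p q)
    then show ?case using assms(3) by (simp flip: plus_ug.abs_eq)
  qed
  then show ?thesis by (metis Quotient3_abs_rep[OF Quotient3_ug])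
qed

section \<open>Polynomials in C and the normal form\<close>

text \<open>A free upper bound lets polynomials of different degrees share one index range.\<close>

lemma ug0_incl_eq:
  "degree p \<le> n \<Longrightarrow> ug0_incl p = (\<Sum>k\<le>n. ug_const (coeff p k) * ug_gen GC ^ k)"
  unfolding ug0_incl_def
  by (rule sum.mono_neutral_left) (auto simp: coeff_eq_0)

lemma ug0_incl_add: "ug0_incl (p + q) = ug0_incl p + ug0_incl q"
proof -
  let ?n = "max (degree p) (degree q)"
  have "degree (p + q) \<le> ?n" by (rule degree_add_le) auto
  then show ?thesis
    by (simp add: ug0_incl_eq[of _ ?n] ug_const_add distrib_right sum.distrib)
qed

lemma ug0_incl_0 [simp]: "ug0_incl 0 = 0"
  by (simp add: ug0_incl_def)

lemma ug0_incl_uminus: "ug0_incl (- p) = - ug0_incl p"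
  using ug0_incl_add[of p "- p"] by (simp add: eq_neg_iff_add_eq_0 add.commute)

lemma ug0_incl_pCons: "ug0_incl (pCons a p) = ug_const a + ug_gen GC * ug0_incl p"
proof -
  have "ug0_incl (pCons a p) = (\<Sum>k\<le>Suc (degree p). ug_const (coeff (pCons a p) k) * ug_gen GC ^ k)"
    by (rule ug0_incl_eq) (rule degree_pCons_le)
  also have "\<dots> = ug_const a + (\<Sum>k\<le>degree p. ug_const (coeff p k) * (ug_gen GC * ug_gen GC ^ k))"
    by (simp add: sum.atMost_Suc_shift del: sum.atMost_Suc)
  also have "(\<Sum>k\<le>degree p. ug_const (coeff p k) * (ug_gen GC * ug_gen GC ^ k))
      = ug_gen GC * ug0_incl p"
    unfolding ug0_incl_def sum_distrib_left
    by (intro sum.cong refl) (metis mult.assoc ug_const_commute)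
  finally show ?thesis .
qed

lemma ug0_incl_const [simp]: "ug0_incl [:c:] = ug_const c"
  by (simp add: ug0_incl_pCons)

lemma ug_gen_ug0_incl: "ug_gen x * ug0_incl p = ug0_incl p * ug_gen x"
proof (induction p)
  case (pCons a p)
  have "ug_gen x * (ug_gen GC * ug0_incl p) = ug_gen GC * (ug_gen x * ug0_incl p)"
    by (cases x) (simp_all add: mult.assoc[symmetric] ug_gen_Z_C)
  then show ?case
    using pCons.IH
    by (simp add: ug0_incl_pCons distrib_left distrib_right mult.assoc ug_const_commute)
qed simp

text \<open>Left multiplication by C shifts both polynomials. Left multiplication by Z sends the
  pair (p, q) to (-C q, p), because Z commutes with polynomials in C and Z Z = -C.\<close>

lemma ug_normal_form: "\<exists>p q. X = ug0_incl p + ug0_incl q * ug_gen GZ"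
proof (induction X rule: ug_induct)
  case (const c)
  show ?case by (rule exI[of _ "[:c:]"], rule exI[of _ 0]) simp
next
  case (gen x X)
  then obtain p q where X: "X = ug0_incl p + ug0_incl q * ug_gen GZ" by blast
  show ?case
  proof (cases x)
    case GC
    then have "ug_gen x * X = ug0_incl (pCons 0 p) + ug0_incl (pCons 0 q) * ug_gen GZ"
      by (simp add: X ug0_incl_pCons distrib_left mult.assoc)
    then show ?thesis by blast
  next
    case GZ
    have "ug_gen GZ * (ug0_incl q * ug_gen GZ) = ug0_incl q * (ug_gen GZ * ug_gen GZ)"
      by (simp add: mult.assoc[symmetric] ug_gen_ug0_incl)
    also have "\<dots> = - (ug_gen GC * ug0_incl q)"
      by (simp add: ug_gen_Z_Z ug_gen_ug0_incl)
    finally have "ug_gen x * X = ug0_incl (pCons 0 (- q)) + ug0_incl p * ug_gen GZ"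
      using GZ by (simp add: X ug0_incl_pCons ug0_incl_uminus distrib_left ug_gen_ug0_incl)
    then show ?thesis by blast
  qed
next
  case (add X Y)
  then obtain p q p' q' where "X = ug0_incl p + ug0_incl q * ug_gen GZ"
    "Y = ug0_incl p' + ug0_incl q' * ug_gen GZ" by blast
  then have "X + Y = ug0_incl (p + p') + ug0_incl (q + q') * ug_gen GZ"
    by (simp add: ug0_incl_add distrib_right)
  then show ?case by blast
qed

section \<open>Sections and matrix coefficients\<close>

lemma sections_smooth: "\<phi> \<in> sections \<Longrightarrow> smooth_circle (\<phi> X)"
  and sections_add: "\<phi> \<in> sections \<Longrightarrow> \<phi> (X + Y) = (\<lambda>z. \<phi> X z + \<phi> Y z)"
  and sections_ug0: "\<phi> \<in> sections \<Longrightarrow> \<phi> (ug0_incl p * X) = ug0_act p (\<phi> X)"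
  by (auto simp: sections_def)

lemma ug0_act_add:
  "smooth_circle f \<Longrightarrow> smooth_circle g \<Longrightarrow>
    ug0_act p (\<lambda>z. f z + g z) = (\<lambda>z. ug0_act p f z + ug0_act p g z)"
  by (simp add: ug0_act_def C_field_funpow_add distrib_left sum.distrib)

lemma ug0_act_mult:
  "smooth_circle f \<Longrightarrow> ug0_act p (\<lambda>z. c * f z) = (\<lambda>z. c * ug0_act p f z)"
  by (simp add: ug0_act_def C_field_funpow_mult sum_distrib_left mult.left_commute)

lemma section_scale_in_sections:
  assumes "\<phi> \<in> sections"
  shows "section_scale c \<phi> \<in> sections"
  using assms unfolding sections_def section_scale_def
  by (auto simp: fun_eq_iff distrib_left ug0_act_mult smooth_circle_mult)

text \<open>This supplies differences of sections for the seminorms and keeps the span of the matrix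
  coefficients among the sections.\<close>

lemma sections_subspace: "section_space.subspace sections"
proof (rule section_space.subspaceI)
  have "(\<lambda>X z. 0) \<in> sections"
    using ug0_act_mult[OF smooth_circle_const, of _ 0 0]
    by (simp add: sections_def smooth_circle_const fun_eq_iff)
  then show "0 \<in> sections" by (simp add: zero_fun_def)
next
  fix \<phi> \<psi> assume "\<phi> \<in> sections" "\<psi> \<in> sections"
  then have "(\<lambda>X z. \<phi> X z + \<psi> X z) \<in> sections"
    unfolding sections_def by (auto simp: fun_eq_iff ug0_act_add smooth_circle_add)
  then show "\<phi> + \<psi> \<in> sections" by (simp add: plus_fun_def)
qed (rule section_scale_in_sections)

text \<open>A polynomial in C is a sum of scaled powers, so by additivity the condition for all
  \<open>p\<close> reduces to scalars and to one factor C.\<close>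

lemma sectionsI:
  assumes smooth: "\<And>X. smooth_circle (\<phi> X)"
    and add: "\<And>X Y z. \<phi> (X + Y) z = \<phi> X z + \<phi> Y z"
    and const: "\<And>c X z. \<phi> (ug_const c * X) z = c * \<phi> X z"
    and C: "\<And>X. \<phi> (ug_gen GC * X) = C_field (\<phi> X)"
  shows "\<phi> \<in> sections"
proof -
  have zero: "\<phi> 0 z = 0" for z using const[of 0 0 z] by simp
  have sum: "\<phi> (sum F A) z = (\<Sum>k\<in>A. \<phi> (F k) z)" if "finite A" for F :: "nat \<Rightarrow> ug" and A z
    using that by (induction A) (simp_all add: zero add)
  have pow: "\<phi> (ug_gen GC ^ k * X) = (C_field ^^ k) (\<phi> X)" for k X
    by (induction k) (simp_all add: mult.assoc C)
  have "\<phi> (ug0_incl p * X) = ug0_act p (\<phi> X)" for p X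
    by (rule ext)
       (simp add: ug0_incl_def sum_distrib_right sum mult.assoc const pow ug0_act_def)
  then show ?thesis using smooth add by (auto simp: sections_def fun_eq_iff)
qed

section \<open>Matrix coefficients as sections\<close>

text \<open>For fixed \<open>X\<close> the coefficient is a real linear functional of
  \<open>grp R g\<close>, so it inherits smoothness. The differential of \<open>grp R\<close> is
  prescribed only at the identity; multiplicativity carries it to every point.\<close>

lemma matrix_coeff_in_sections:
  fixes R :: "('n::finite) srep"
  assumes R: "is_srep R" and \<omega>: "Vector_Spaces.linear (*s) (*) \<omega>"
  shows "matrix_coeff R \<omega> v \<in> sections"
proof (rule sectionsI)
  interpret \<omega>: Vector_Spaces.linear "(*s)" "(*)" \<omega> by (rule \<omega>)
  have br: "preserves_bracket (alg R)" using R by (simp add: is_srep_def)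
  note hom = ug_eval_hom[OF br]
  define L :: "complex^'n^'n \<Rightarrow> complex^'n^'n \<Rightarrow> complex" where "L A M = \<omega> (M *v (A *v v))" for A M
  have mc: "matrix_coeff R \<omega> v X = (\<lambda>g. L (ug_eval (alg R) X) (grp R g))" for X
    by (simp add: matrix_coeff_def L_def)
  \<comment> \<open>\<open>bounded_linear\<close> refers to real scaling, while \<omega> is linear
    for complex scaling; these facts translate between the two.\<close>
  have scaleR: "c *\<^sub>R x = of_real c *s x" for c and x :: "complex^'n"
    by (simp only: vec_eq_iff vector_scaleR_component vector_smult_component)
       (simp add: scaleR_conv_of_real)
  have scaleR_complex: "c *\<^sub>R y = of_real c * y" for c and y :: complex
    by (rule scaleR_conv_of_real)
  have scaleR_matrix: "(c *\<^sub>R M) *v x = c *\<^sub>R (M *v x)" for c and M :: "complex^'n^'n" and x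
    by (simp add: vec_eq_iff matrix_vector_mult_def scaleR_sum_right)
  have L: "bounded_linear (L A)" for A
    by (intro linear_conv_bounded_linear[THEN iffD1] linearI)
       (simp_all add: L_def matrix_vector_mult_add_rdistrib scaleR_matrix
         \<omega>.add scaleR[of _ "_ :: complex^'n"] \<omega>.scale scaleR_complex)
  show "smooth_circle (matrix_coeff R \<omega> v X)" for X
    unfolding mc using R by (intro smooth_circle_bounded_linear[OF L]) (simp add: is_srep_def)
  show "matrix_coeff R \<omega> v (X + Y) z = matrix_coeff R \<omega> v X z + matrix_coeff R \<omega> v Y z" for X Y z
    by (simp add: matrix_coeff_def hom matrix_vector_mult_add_rdistrib
        matrix_vector_right_distrib \<omega>.add)
  have mat: "mat c *v x = c *s x" for c and x :: "complex^'n"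
    by (simp add: vec_eq_iff matrix_vector_mult_def mat_def if_distrib if_distribR cong: if_cong)
  show "matrix_coeff R \<omega> v (ug_const c * X) z = c * matrix_coeff R \<omega> v X z" for c X z
    by (simp add: matrix_coeff_def hom matrix_vector_mul_assoc[symmetric] mat
        vector_scalar_commute \<omega>.scale)
  show "matrix_coeff R \<omega> v (ug_gen GC * X) = C_field (matrix_coeff R \<omega> v X)" for X
  proof (rule C_field_eqI[symmetric])
    fix t
    let ?G = "grp R (circle_exp t)"
    let ?A = "ug_eval (alg R) X"
    have "linear (\<lambda>M. ?G ** M)"
      by (intro linearI)
         (simp_all add: vec_eq_iff matrix_matrix_mult_def scaleR_sum_right distrib_left sum.distrib)
    then have "bounded_linear (\<lambda>M. L ?A (?G ** M))"
      by (intro bounded_linear_compose[OF L] linear_conv_bounded_linear[THEN iffD1])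
    moreover have "((\<lambda>s. grp R (circle_exp s)) has_vector_derivative (mat \<i> ** alg R GC)) (at 0)"
      using R by (simp add: is_srep_def)
    ultimately have "((\<lambda>s. L ?A (?G ** grp R (circle_exp s))) has_vector_derivative
        L ?A (?G ** (mat \<i> ** alg R GC))) (at 0)"
      by (rule bounded_linear.has_vector_derivative)
    \<comment> \<open>Multiplicativity of \<open>grp R\<close> turns left multiplication by
      \<open>?G\<close> into translation of the argument.\<close>
    also have "(\<lambda>s. L ?A (?G ** grp R (circle_exp s)))
        = (\<lambda>s. matrix_coeff R \<omega> v X (circle_exp t * circle_exp s))"
      using R by (simp add: mc is_srep_def)
    also have "L ?A (?G ** (mat \<i> ** alg R GC))
        = \<i> * matrix_coeff R \<omega> v (ug_gen GC * X) (circle_exp t)"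
      by (simp add: matrix_coeff_def L_def hom matrix_vector_mul_assoc[symmetric] mat
        vector_scalar_commute \<omega>.scale)
    finally show "((\<lambda>s. matrix_coeff R \<omega> v X (circle_exp s)) has_vector_derivative
        \<i> * matrix_coeff R \<omega> v (ug_gen GC * X) (circle_exp t)) (at t)"
      unfolding has_vector_derivative_circle_exp_iff .
  qed
qed

lemma matrix_coeffs_subset_sections: "is_srep R \<Longrightarrow> matrix_coeffs R \<subseteq> sections"
  unfolding matrix_coeffs_def using matrix_coeff_in_sections by blast

text \<open>The j-th basis vector and the i-th coordinate functional read off a matrix entry; the
  scale \<open>c\<close> absorbs normalisations such as 1 / r.\<close>

lemma matrix_coeff_entry:
  assumes "is_srep R"
  shows "\<exists>\<psi>\<in>matrix_coeffs R. \<psi> 1 = (\<lambda>z. c * grp R z $ i $ j)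
    \<and> \<psi> (ug_gen x) = (\<lambda>z. c * (grp R z ** alg R x) $ i $ j)"
proof -
  have br: "preserves_bracket (alg R)" using assms by (simp add: is_srep_def)
  note hom = ug_eval_hom(4)[OF br] ug_eval_hom(3)[OF br, of 1, simplified]
  have column: "A *v axis j 1 = (\<chi> i. A $ i $ j)" for A :: "complex^'a^'a"
    by (simp add: vec_eq_iff matrix_vector_mult_def axis_def if_distrib cong: if_cong)
  let ?\<psi> = "matrix_coeff R (\<lambda>x. c * x $ i) (axis j 1)"
  have "Vector_Spaces.linear (*s) (*) (\<lambda>x :: complex^'a. c * x $ i)"
    by unfold_locales (auto simp: algebra_simps)
  then have "?\<psi> \<in> matrix_coeffs R" unfolding matrix_coeffs_def by blast
  moreover have "?\<psi> 1 = (\<lambda>z. c * grp R z $ i $ j)"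
    "?\<psi> (ug_gen x) = (\<lambda>z. c * (grp R z ** alg R x) $ i $ j)"
    by (simp_all only: matrix_coeff_def hom matrix_vector_mul_assoc) (simp_all add: column)
  ultimately show ?thesis by blast
qed

text \<open>The group acts by scalars and Z is off-diagonal: entry (1, 1) sees only the group part,
  entry (2, 1) only Z with value \<open>r\<close>. Since m is nonzero, \<open>r\<close> can be
  divided out.\<close>

lemma weight_rep_char:
  assumes r: "r\<^sup>2 = - of_int m" and m: "m \<noteq> 0"
  shows "\<exists>\<psi>\<in>matrix_coeffs (weight_rep e r m).
      \<psi> 1 = (\<lambda>z. of_circle z powi m) \<and> \<psi> (ug_gen GZ) = (\<lambda>_. 0)"
    and "\<exists>\<psi>\<in>matrix_coeffs (weight_rep e r m).
      \<psi> 1 = (\<lambda>_. 0) \<and> \<psi> (ug_gen GZ) = (\<lambda>z. of_circle z powi m)"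
proof -
  have "r \<noteq> 0" using assms by auto
  note R = is_srep_weight_rep[OF r, of e]
  have entries: "grp (weight_rep e r m) z = mat (of_circle z powi m)"
    "alg (weight_rep e r m) GZ $ 1 $ 1 = 0" "alg (weight_rep e r m) GZ $ 2 $ 1 = r"
    "(mat c :: complex^2^2) $ 1 $ 1 = c" "(mat c :: complex^2^2) $ 2 $ 1 = 0" for z c
    by (simp_all add: weight_rep_def) (simp_all add: mat_def)
  show "\<exists>\<psi>\<in>matrix_coeffs (weight_rep e r m).
      \<psi> 1 = (\<lambda>z. of_circle z powi m) \<and> \<psi> (ug_gen GZ) = (\<lambda>_. 0)"
    using matrix_coeff_entry[OF R, of 1 1 1 GZ]
    by (simp add: entries mat_mult_nth)
  show "\<exists>\<psi>\<in>matrix_coeffs (weight_rep e r m).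
      \<psi> 1 = (\<lambda>_. 0) \<and> \<psi> (ug_gen GZ) = (\<lambda>z. of_circle z powi m)"
    using matrix_coeff_entry[OF R, of "1 / r" 2 1 GZ] \<open>r \<noteq> 0\<close>
    by (simp add: entries mat_mult_nth)
qed

lemma triv_rep_char:
  "\<exists>\<psi>\<in>matrix_coeffs triv_rep. \<psi> 1 = (\<lambda>_. 1) \<and> \<psi> (ug_gen GZ) = (\<lambda>_. 0)"
  using matrix_coeff_entry[OF is_srep_triv_rep, of 1 1 1 GZ]
  by (simp add: triv_rep_def) (simp add: mat_def)

text \<open>In weight 0 a square root of -m vanishes, so the off-diagonal entry is taken from the
  nilpotent Z instead.\<close>

lemma minus_rep_char:
  "\<exists>\<psi>\<in>matrix_coeffs (minus_rep e). \<psi> 1 = (\<lambda>_. 0) \<and> \<psi> (ug_gen GZ) = (\<lambda>_. 1)"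
proof -
  have "grp (minus_rep e) z $ 2 $ 1 = 0" "(grp (minus_rep e) z ** alg (minus_rep e) GZ) $ 2 $ 1 = 1" for z
    by (simp_all add: minus_rep_def) (simp add: mat_def)
  then show ?thesis using matrix_coeff_entry[OF is_srep_minus_rep, of e 1 2 1 GZ] by simp
qed

text \<open>Each component is built by induction with the other held at 0, and the two sections are
  then added.\<close>

lemma trig_polys_section:
  assumes S: "section_space.subspace S"
    and even: "\<And>m. \<exists>\<psi>\<in>S. \<psi> 1 = (\<lambda>z. of_circle z powi m) \<and> \<psi> (ug_gen GZ) = (\<lambda>_. 0)"
    and odd: "\<And>m. \<exists>\<psi>\<in>S. \<psi> 1 = (\<lambda>_. 0) \<and> \<psi> (ug_gen GZ) = (\<lambda>z. of_circle z powi m)"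
    and "p \<in> trig_polys" "q \<in> trig_polys"
  shows "\<exists>\<psi>\<in>S. \<psi> 1 = p \<and> \<psi> (ug_gen GZ) = q"
proof -
  have sum: "\<exists>\<psi>\<in>S. \<psi> 1 = (\<lambda>z. f z + g z) \<and> \<psi> (ug_gen GZ) = (\<lambda>z. f' z + g' z)"
    if fg: "\<exists>\<psi>\<in>S. \<psi> 1 = f \<and> \<psi> (ug_gen GZ) = f'" "\<exists>\<psi>\<in>S. \<psi> 1 = g \<and> \<psi> (ug_gen GZ) = g'" for f f' g g'
  proof -
    obtain \<phi> \<psi> where "\<phi> \<in> S" "\<phi> 1 = f" "\<phi> (ug_gen GZ) = f'" "\<psi> \<in> S" "\<psi> 1 = g" "\<psi> (ug_gen GZ) = g'"
      using fg by blast
    then show ?thesis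
      by (intro bexI[of _ "\<phi> + \<psi>"] section_space.subspace_add[OF S]) (auto simp: fun_eq_iff)
  qed
  have scale: "\<exists>\<psi>\<in>S. \<psi> 1 = (\<lambda>z. c * f z) \<and> \<psi> (ug_gen GZ) = (\<lambda>z. c * f' z)"
    if f: "\<exists>\<psi>\<in>S. \<psi> 1 = f \<and> \<psi> (ug_gen GZ) = f'" for c f f'
  proof -
    obtain \<psi> where "\<psi> \<in> S" "\<psi> 1 = f" "\<psi> (ug_gen GZ) = f'" using f by blast
    then show ?thesis
      by (intro bexI[of _ "section_scale c \<psi>"] section_space.subspace_scale[OF S])
         (auto simp: section_scale_def)
  qed
  have "\<exists>\<psi>\<in>S. \<psi> 1 = p \<and> \<psi> (ug_gen GZ) = (\<lambda>_. 0)"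
    using assms(4)
  proof (induction rule: trig_polys.induct)
    case (char c m)
    show ?case using scale[OF even, of c m] by simp
  next
    case (add f g)
    show ?case using sum[OF add.IH] by simp
  qed
  moreover have "\<exists>\<psi>\<in>S. \<psi> 1 = (\<lambda>_. 0) \<and> \<psi> (ug_gen GZ) = q"
    using assms(5)
  proof (induction rule: trig_polys.induct)
    case (char c m)
    show ?case using scale[OF odd, of c m] by simp
  next
    case (add f g)
    show ?case using sum[OF add.IH] by simp
  qed
  ultimately show ?thesis using sum[of p "\<lambda>_. 0" "\<lambda>_. 0" q] by simp
qed

section \<open>Density\<close>

lemma cmod_ug0_act_le:
  assumes "\<And>k. k \<le> degree p \<Longrightarrow> cmod ((C_field ^^ k) f z) \<le> B"
  shows "cmod (ug0_act p f z) \<le> (\<Sum>k\<le>degree p. cmod (coeff p k)) * B"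
  unfolding ug0_act_def sum_distrib_right
  by (rule sum_norm_le) (simp add: norm_mult assms mult_left_mono)

text \<open>The normal form of \<open>X\<close> expresses \<open>\<phi> X\<close> by derivatives of
  the two components. \<open>K\<close> and \<open>N\<close> depend on \<open>X\<close> alone, so one
  pair of approximations can serve finitely many seminorms.\<close>

lemma section_bound:
  obtains K :: "ug \<Rightarrow> real" and N :: "ug \<Rightarrow> nat" where "\<And>X. 0 \<le> K X"
    and "\<And>X \<phi> B z. \<phi> \<in> sections \<Longrightarrow>
      (\<And>k z. k \<le> N X \<Longrightarrow> cmod ((C_field ^^ k) (\<phi> 1) z) \<le> B) \<Longrightarrow>
      (\<And>k z. k \<le> N X \<Longrightarrow> cmod ((C_field ^^ k) (\<phi> (ug_gen GZ)) z) \<le> B) \<Longrightarrow>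
      cmod (\<phi> X z) \<le> K X * B"
proof -
  obtain p q where pq: "\<And>X. X = ug0_incl (p X) + ug0_incl (q X) * ug_gen GZ"
    using ug_normal_form by metis
  define K where "K p = (\<Sum>k\<le>degree p. cmod (coeff p k))" for p
  show thesis
  proof (rule that[of "\<lambda>X. K (p X) + K (q X)" "\<lambda>X. max (degree (p X)) (degree (q X))"])
    show "0 \<le> K (p X) + K (q X)" for X by (simp add: K_def sum_nonneg)
    fix X \<phi> B z
    assume \<phi>: "\<phi> \<in> sections"
      and B: "\<And>k z. k \<le> max (degree (p X)) (degree (q X)) \<Longrightarrow> cmod ((C_field ^^ k) (\<phi> 1) z) \<le> B"
        "\<And>k z. k \<le> max (degree (p X)) (degree (q X)) \<Longrightarrow>
          cmod ((C_field ^^ k) (\<phi> (ug_gen GZ)) z) \<le> B"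
    \<comment> \<open>The explicit factor 1 gives the first summand the shape to which
      \<open>sections_ug0\<close> applies.\<close>
    have "\<phi> X = \<phi> (ug0_incl (p X) * 1 + ug0_incl (q X) * ug_gen GZ)"
      using pq[of X] by simp
    then have "\<phi> X z = ug0_act (p X) (\<phi> 1) z + ug0_act (q X) (\<phi> (ug_gen GZ)) z"
      by (simp only: sections_add[OF \<phi>] sections_ug0[OF \<phi>])
    also have "cmod \<dots> \<le> K (p X) * B + K (q X) * B"
      unfolding K_def by (intro norm_triangle_mono cmod_ug0_act_le B) simp_all
    finally show "cmod (\<phi> X z) \<le> (K (p X) + K (q X)) * B" by (simp add: distrib_right)
  qed
qed

text \<open>The generating balls form only a subbasis and have arbitrary centres. The triangle
  inequality recentres them at \<phi>; intersections unite the finite sets and take the smaller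
  radius.\<close>

lemma openin_section_topologyD:
  assumes "openin section_topology T" "\<phi> \<in> T"
  shows "\<exists>F \<epsilon>. finite F \<and> 0 < \<epsilon> \<and>
    (\<forall>\<psi>\<in>sections. (\<forall>X\<in>F. \<forall>z. cmod (\<psi> X z - \<phi> X z) \<le> \<epsilon>) \<longrightarrow> \<psi> \<in> T)"
  using openin_topology_generated_by[OF assms(1)[unfolded section_topology_def]] assms(2)
proof (induction rule: generate_topology_on.induct)
  case (Int a b)
  then have "\<phi> \<in> a" "\<phi> \<in> b" by auto
  obtain F \<epsilon> where F: "finite F" "0 < \<epsilon>"
    "\<forall>\<psi>\<in>sections. (\<forall>X\<in>F. \<forall>z. cmod (\<psi> X z - \<phi> X z) \<le> \<epsilon>) \<longrightarrow> \<psi> \<in> a"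
    using Int.IH(1)[OF \<open>\<phi> \<in> a\<close>] by (elim exE conjE)
  obtain G \<delta> where G: "finite G" "0 < \<delta>"
    "\<forall>\<psi>\<in>sections. (\<forall>X\<in>G. \<forall>z. cmod (\<psi> X z - \<phi> X z) \<le> \<delta>) \<longrightarrow> \<psi> \<in> b"
    using Int.IH(2)[OF \<open>\<phi> \<in> b\<close>] by (elim exE conjE)
  show ?case
    using F G by (intro exI[of _ "F \<union> G"] exI[of _ "min \<epsilon> \<delta>"]) auto
next
  case (UN K)
  then obtain k where "k \<in> K" "\<phi> \<in> k" by blast
  from UN.IH[OF this] obtain F \<epsilon> where "finite F" "0 < \<epsilon>"
    "\<forall>\<psi>\<in>sections. (\<forall>X\<in>F. \<forall>z. cmod (\<psi> X z - \<phi> X z) \<le> \<epsilon>) \<longrightarrow> \<psi> \<in> k"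
    by (elim exE conjE)
  with \<open>k \<in> K\<close> show ?case by (intro exI[of _ F] exI[of _ \<epsilon>]) auto
next
  case (Basis T)
  then obtain X \<phi>\<^sub>0 \<epsilon> where T: "T = {\<psi> \<in> sections. section_seminorm X (\<psi> - \<phi>\<^sub>0) < \<epsilon>}"
    and "\<phi>\<^sub>0 \<in> sections" by blast
  define s where "s = section_seminorm X (\<phi> - \<phi>\<^sub>0)"
  have s: "s < \<epsilon>" and "\<phi> \<in> sections" using Basis.prems by (auto simp: T s_def)
  have "bdd_above (range (\<lambda>z. cmod ((\<phi> - \<phi>\<^sub>0) X z)))"
    by (intro bdd_above_smooth_circle sections_smooth
        section_space.subspace_diff[OF sections_subspace] \<open>\<phi> \<in> sections\<close> \<open>\<phi>\<^sub>0 \<in> sections\<close>)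
  then have le: "cmod (\<phi> X z - \<phi>\<^sub>0 X z) \<le> s" for z
    unfolding s_def section_seminorm_def using cSUP_upper[of z UNIV] by fastforce
  \<comment> \<open>Pointwise bounds yield only a non-strict bound on the supremum; half of the gap
    keeps the total strictly below \<epsilon>.\<close>
  have "\<psi> \<in> T" if "\<psi> \<in> sections" "\<forall>z. cmod (\<psi> X z - \<phi> X z) \<le> (\<epsilon> - s) / 2" for \<psi>
  proof -
    have "cmod (\<psi> X z - \<phi>\<^sub>0 X z) \<le> (\<epsilon> - s) / 2 + s" for z
      using norm_triangle_mono[OF that(2)[rule_format, of z] le[of z]] by simp
    then have "section_seminorm X (\<psi> - \<phi>\<^sub>0) \<le> (\<epsilon> - s) / 2 + s"
      unfolding section_seminorm_def by (intro cSUP_least) simp_all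
    also have "\<dots> < \<epsilon>" using s by (simp add: field_simps)
    finally show ?thesis using that(1) by (simp add: T)
  qed
  then show ?case using s by (intro exI[of _ "{X}"] exI[of _ "(\<epsilon> - s) / 2"]) simp
qed simp

text \<open>A neighbourhood contains one cut out by finitely many seminorms, these are controlled by
  finitely many derivatives of the two components, and the components can be approximated
  independently.\<close>

lemma section_topology_dense:
  assumes S: "section_space.subspace S" "S \<subseteq> sections"
    and even: "\<And>m. \<exists>\<psi>\<in>S. \<psi> 1 = (\<lambda>z. of_circle z powi m) \<and> \<psi> (ug_gen GZ) = (\<lambda>_. 0)"
    and odd: "\<And>m. \<exists>\<psi>\<in>S. \<psi> 1 = (\<lambda>_. 0) \<and> \<psi> (ug_gen GZ) = (\<lambda>z. of_circle z powi m)"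
  shows "section_topology closure_of S = topspace section_topology"
proof
  show "topspace section_topology \<subseteq> section_topology closure_of S"
    unfolding in_closure_of subset_iff
  proof (intro allI impI conjI; (elim conjE)?)
    fix \<phi> T assume "\<phi> \<in> topspace section_topology" "\<phi> \<in> T" "openin section_topology T"
    then have \<phi>: "\<phi> \<in> sections" by (simp add: topspace_section_topology)
    obtain F \<epsilon> where F: "finite F" "0 < \<epsilon>"
      "\<And>\<psi>. \<psi> \<in> sections \<Longrightarrow> (\<And>X z. X \<in> F \<Longrightarrow> cmod (\<psi> X z - \<phi> X z) \<le> \<epsilon>) \<Longrightarrow> \<psi> \<in> T"
      using openin_section_topologyD[OF \<open>openin section_topology T\<close> \<open>\<phi> \<in> T\<close>] by metis
    obtain K N where K: "\<And>X. 0 \<le> K X" and NK: "\<And>X \<phi> B z. \<phi> \<in> sections \<Longrightarrow>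
        (\<And>k z. k \<le> N X \<Longrightarrow> cmod ((C_field ^^ k) (\<phi> 1) z) \<le> B) \<Longrightarrow>
        (\<And>k z. k \<le> N X \<Longrightarrow> cmod ((C_field ^^ k) (\<phi> (ug_gen GZ)) z) \<le> B) \<Longrightarrow>
        cmod (\<phi> X z) \<le> K X * B"
      by (fact section_bound)
    \<comment> \<open>Sums of nonnegative terms dominate each term and stay meaningful for empty
      \<open>F\<close>, so they replace maxima.\<close>
    define M where "M = (\<Sum>X\<in>F. N X)"
    define L where "L = (\<Sum>X\<in>F. K X)"
    have L: "0 \<le> L" by (simp add: L_def sum_nonneg K)
    \<comment> \<open>The summand 1 keeps the denominator positive when \<open>L\<close> is
      0.\<close>
    define B where "B = \<epsilon> / (L + 1)"
    have B: "0 < B" using L F(2) by (simp add: B_def)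
    obtain p where p: "p \<in> trig_polys"
        "\<And>k z. k \<le> M \<Longrightarrow> cmod ((C_field ^^ k) (\<lambda>z. \<phi> 1 z - p z) z) \<le> B"
      using trig_polys_dense[OF sections_smooth[OF \<phi>] B] by blast
    obtain q where q: "q \<in> trig_polys"
        "\<And>k z. k \<le> M \<Longrightarrow> cmod ((C_field ^^ k) (\<lambda>z. \<phi> (ug_gen GZ) z - q z) z) \<le> B"
      using trig_polys_dense[OF sections_smooth[OF \<phi>] B] by blast
    obtain \<psi> where \<psi>: "\<psi> \<in> S" "\<psi> 1 = p" "\<psi> (ug_gen GZ) = q"
      using trig_polys_section[OF S(1) even odd p(1) q(1)] by blast
    have d: "(\<phi> - \<psi>) 1 = (\<lambda>z. \<phi> 1 z - p z)" "(\<phi> - \<psi>) (ug_gen GZ) = (\<lambda>z. \<phi> (ug_gen GZ) z - q z)"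
      by (simp_all add: fun_eq_iff \<psi>)
    have diff: "\<phi> - \<psi> \<in> sections"
      using \<psi>(1) S(2) \<phi> by (auto intro: section_space.subspace_diff[OF sections_subspace])
    have "cmod (\<psi> X z - \<phi> X z) \<le> \<epsilon>" if X: "X \<in> F" for X z
    proof -
      have "N X \<le> M" unfolding M_def using F(1) X by (intro member_le_sum) auto
      then have "cmod ((\<phi> - \<psi>) X z) \<le> K X * B"
        using p(2) q(2) by (intro NK[OF diff]) (simp_all add: d del: minus_apply)
      also have "K X \<le> L" unfolding L_def using F(1) X by (intro member_le_sum) (auto simp: K)
      then have "K X * B \<le> (L + 1) * B" using B by (intro mult_right_mono) auto
      also have "(L + 1) * B = \<epsilon>" using L by (simp add: B_def)
      finally show ?thesis by (simp add: norm_minus_commute)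
    qed
    then have "\<psi> \<in> T" using \<psi>(1) S(2) by (intro F(3)) auto
    then show "\<exists>y. y \<in> S \<and> y \<in> T" using \<psi>(1) by blast
  qed
qed (rule closure_of_subset_topspace)

theorem theorem6p3:
  fixes r :: "int \<Rightarrow> complex" and e :: "int \<Rightarrow> bool" and e' :: bool
  assumes "\<And>m. m \<noteq> 0 \<Longrightarrow> (r m)\<^sup>2 = - of_int m"
  shows "let S = section_space.span
      (matrix_coeffs triv_rep
        \<union> (\<Union>m\<in>-{0}. matrix_coeffs (weight_rep (e m) (r m) m))
        \<union> matrix_coeffs (minus_rep e'))
    in S \<subseteq> topspace section_topology
      \<and> section_topology closure_of S = topspace section_topology"
proof -
  define G where "G = matrix_coeffs triv_rep
    \<union> (\<Union>m\<in>-{0}. matrix_coeffs (weight_rep (e m) (r m) m)) \<union> matrix_coeffs (minus_rep e')"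
  let ?S = "section_space.span G"
  \<comment> \<open>\<open>closure_of\<close> ignores points outside the carrier, so inclusion in
    \<open>sections\<close> is established separately.\<close>
  have "G \<subseteq> sections"
    unfolding G_def
    by (intro Un_least UN_least matrix_coeffs_subset_sections is_srep_triv_rep is_srep_minus_rep
        is_srep_weight_rep assms) simp
  then have sub: "?S \<subseteq> sections" by (rule section_space.span_minimal) (rule sections_subspace)
  have G: "G \<subseteq> ?S" by (rule section_space.span_superset)
  have "section_topology closure_of ?S = topspace section_topology"
  proof (rule section_topology_dense[OF section_space.subspace_span sub])
    fix m
    have "\<exists>\<psi>\<in>G. \<psi> 1 = (\<lambda>z. of_circle z powi m) \<and> \<psi> (ug_gen GZ) = (\<lambda>_. 0)"
    proof (cases "m = 0")
      case True
      then show ?thesis using triv_rep_char unfolding G_def by auto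
    next
      case False
      then show ?thesis
        using weight_rep_char(1)[OF assms, of m "e m"] unfolding G_def by blast
    qed
    then show "\<exists>\<psi>\<in>?S. \<psi> 1 = (\<lambda>z. of_circle z powi m) \<and> \<psi> (ug_gen GZ) = (\<lambda>_. 0)"
      using G by blast
    have "\<exists>\<psi>\<in>G. \<psi> 1 = (\<lambda>_. 0) \<and> \<psi> (ug_gen GZ) = (\<lambda>z. of_circle z powi m)"
    proof (cases "m = 0")
      case True
      then show ?thesis using minus_rep_char[of e'] unfolding G_def by auto
    next
      case False
      then show ?thesis
        using weight_rep_char(2)[OF assms, of m "e m"] unfolding G_def by blast
    qed
    then show "\<exists>\<psi>\<in>?S. \<psi> 1 = (\<lambda>_. 0) \<and> \<psi> (ug_gen GZ) = (\<lambda>z. of_circle z powi m)"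
      using G by blast
  qed
  then show ?thesis using sub by (simp add: G_def topspace_section_topology)
qed

end
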